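(* Let $m\ge 1$ and let $M$ be the generic countable $K_m$-free graph. Then $M$ has the Small Index Property.
   Context: A graph is a set with a symmetric irreflexive binary relation. A graph is $K_m$-free if the complete graph on $m$ vertices does not embed into it. The generic countable $K_m$-free graph is the Fraïssé limit of the class of all finite $K_m$-free graphs, i.e. the (unique up to isomorphism) countable homogeneous graph whose finite induced subgraphs are, up to isomorphism, exactly the finite $K_m$-free graphs. A countable structure $M$ has the Small Index Property if every subgroup of $\mathrm{Aut}(M)$ of index less than $2^{\aleph_0}$ contains the pointwise stabilizer in $\mathrm{Aut}(M)$ of some finite subset of $M$. *)

theory Defs
  imports "HOL-Algebra.Bij" "HOL-Algebra.Coset" "HOL-Library.Equipollence" "HOL-Library.Countable_Set"
begin

definition graph :: "'a set \<Rightarrow> 'a rel \<Rightarrow> bool" where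
  "graph V E \<longleftrightarrow> E \<subseteq> V \<times> V \<and> sym E \<and> irrefl E"

definition induced_edges :: "'a rel \<Rightarrow> 'a set \<Rightarrow> 'a rel" where
  "induced_edges E S = E \<inter> (S \<times> S)"

definition graph_embedding ::
    "('a \<Rightarrow> 'b) \<Rightarrow> 'a set \<Rightarrow> 'a rel \<Rightarrow> 'b set \<Rightarrow> 'b rel \<Rightarrow> bool" where
  "graph_embedding f V E W F \<longleftrightarrow>
     inj_on f V \<and> f ` V \<subseteq> W \<and> (\<forall>x\<in>V. \<forall>y\<in>V. (f x, f y) \<in> F \<longleftrightarrow> (x, y) \<in> E)"

definition graph_isomorphism ::
    "('a \<Rightarrow> 'b) \<Rightarrow> 'a set \<Rightarrow> 'a rel \<Rightarrow> 'b set \<Rightarrow> 'b rel \<Rightarrow> bool" where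
  "graph_isomorphism f V E W F \<longleftrightarrow>
     bij_betw f V W \<and> (\<forall>x\<in>V. \<forall>y\<in>V. (f x, f y) \<in> F \<longleftrightarrow> (x, y) \<in> E)"

definition complete_edges :: "'a set \<Rightarrow> 'a rel" where
  "complete_edges V = {(x, y). x \<in> V \<and> y \<in> V \<and> x \<noteq> y}"

definition complete_free :: "nat \<Rightarrow> 'a set \<Rightarrow> 'a rel \<Rightarrow> bool" where
  "complete_free m V E \<longleftrightarrow>
     \<not> (\<exists>f :: nat \<Rightarrow> 'a. graph_embedding f {..<m} (complete_edges {..<m}) V E)"

text \<open>As in \<^const>\<open>Bij\<close>, automorphisms are functions extensional on the vertex set, so that
  each automorphism has exactly one representative.\<close>

definition graph_aut :: "'a set \<Rightarrow> 'a rel \<Rightarrow> ('a \<Rightarrow> 'a) monoid" where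
  "graph_aut V E = BijGroup V \<lparr>carrier := {f \<in> Bij V. graph_isomorphism f V E V E}\<rparr>"

definition homogeneous_graph :: "'a set \<Rightarrow> 'a rel \<Rightarrow> bool" where
  "homogeneous_graph V E \<longleftrightarrow>
     (\<forall>A B f. finite A \<and> A \<subseteq> V \<and> B \<subseteq> V \<and>
        graph_isomorphism f A (induced_edges E A) B (induced_edges E B) \<longrightarrow>
        (\<exists>g \<in> carrier (graph_aut V E). \<forall>x\<in>A. g x = f x))"

text \<open>Every finite graph is isomorphic to one whose vertices are natural numbers, so the age
  condition only ranges over those. The vertex set may be finite or even empty: for
  \<open>m = 1\<close> the only complete-free graph is the empty one.\<close>

definition generic_complete_free_graph :: "nat \<Rightarrow> 'a set \<Rightarrow> 'a rel \<Rightarrow> bool" where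
  "generic_complete_free_graph m V E \<longleftrightarrow>
     graph V E \<and> countable V \<and> homogeneous_graph V E \<and>
     (\<forall>S. finite S \<and> S \<subseteq> V \<longrightarrow> complete_free m S (induced_edges E S)) \<and>
     (\<forall>(W :: nat set) F. finite W \<and> graph W F \<and> complete_free m W F \<longrightarrow>
        (\<exists>S f. S \<subseteq> V \<and> graph_isomorphism f W F S (induced_edges E S)))"

definition pointwise_stabilizer :: "'a set \<Rightarrow> 'a rel \<Rightarrow> 'a set \<Rightarrow> ('a \<Rightarrow> 'a) set" where
  "pointwise_stabilizer V E A = {g \<in> carrier (graph_aut V E). \<forall>x\<in>A. g x = x}"

definition small_index_property :: "'a set \<Rightarrow> 'a rel \<Rightarrow> bool" where
  "small_index_property V E \<longleftrightarrow>
     (\<forall>H. subgroup H (graph_aut V E) \<and>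
        (rcosets\<^bsub>graph_aut V E\<^esub> H) \<prec> (UNIV :: nat set set) \<longrightarrow>
        (\<exists>A. finite A \<and> A \<subseteq> V \<and> pointwise_stabilizer V E A \<subseteq> H))"

lemma group_graph_aut: "group (graph_aut V E)"
proof -
  interpret B: group "BijGroup V" by (rule group_BijGroup)
  let ?C = "{f \<in> Bij V. graph_isomorphism f V E V E}"
  have "subgroup ?C (BijGroup V)"
  proof (rule B.subgroupI)
    show "?C \<subseteq> carrier (BijGroup V)" by (auto simp: BijGroup_def)
    have "(\<lambda>x\<in>V. x) \<in> ?C"
      using id_Bij[of V] by (auto simp: graph_isomorphism_def Bij_def)
    then show "?C \<noteq> {}" by blast
  next
    fix f assume f: "f \<in> ?C"
    then have fB: "f \<in> Bij V" and bij: "bij_betw f V V"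
      by (auto simp: Bij_def)
    let ?g = "\<lambda>x\<in>V. inv_into V f x"
    have gB: "?g \<in> Bij V" using fB by (rule restrict_inv_into_Bij)
    have *: "f (?g x) = x" "?g x \<in> V" if "x \<in> V" for x
      using that bij by (auto simp: bij_betw_inv_into_right bij_betw_def inv_into_into)
    have "(?g x, ?g y) \<in> E \<longleftrightarrow> (x, y) \<in> E" if "x \<in> V" "y \<in> V" for x y
    proof -
      have "(f (?g x), f (?g y)) \<in> E \<longleftrightarrow> (?g x, ?g y) \<in> E"
        using f *(2)[OF that(1)] *(2)[OF that(2)] unfolding graph_isomorphism_def by blast
      then show ?thesis unfolding *(1)[OF that(1)] *(1)[OF that(2)] by simp
    qed
    then have "?g \<in> ?C" using gB by (simp add: graph_isomorphism_def Bij_def)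
    then show "inv\<^bsub>BijGroup V\<^esub> f \<in> ?C" by (simp only: inv_BijGroup[OF fB])
  next
    fix f g assume fg: "f \<in> ?C" "g \<in> ?C"
    then have "compose V f g \<in> Bij V" by (auto intro: compose_Bij)
    moreover have "g x \<in> V" if "x \<in> V" for x
      using fg that by (auto simp: Bij_def bij_betw_def)
    ultimately have "compose V f g \<in> ?C"
      using fg by (auto simp: graph_isomorphism_def Bij_def compose_def)
    then show "f \<otimes>\<^bsub>BijGroup V\<^esub> g \<in> ?C" using fg by (simp add: BijGroup_def)
  qed
  then show ?thesis
    unfolding graph_aut_def by (rule B.subgroup_imp_group)
qed

end

theory Submission imports Defs begin

text \<open>The proof follows Hodges, Hodkinson, Lascar and Shelah. Finite \<open>K\<^sub>m\<close>-free graphs have the extension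
  property for partial automorphisms and amalgamate freely, hence the automorphism group has generic
  tuples of every length, and a comeager set of automorphisms extends a given generic tuple to a
  longer one. Let \<open>H\<close> have small index and contain no pointwise stabilizer of a finite set. By a
  Mycielski argument \<open>H\<close> meets every comeager subset of every stabilizer, and so does its complement.
  This yields \<open>x\<^sub>n \<in> H\<close> and \<open>y\<^sub>n \<notin> H\<close> such that every tuple that picks one of \<open>x\<^sub>i, y\<^sub>i\<close> for each \<open>i\<close> is
  generic. Two generic tuples that agree on a finite invariant set are conjugate over it, which gives
  automorphisms \<open>q\<^sub>a\<close> for \<open>a \<subseteq> \<nat>\<close> such that \<open>q\<^sub>a\<close> and \<open>q\<^sub>b\<close> conjugate \<open>y\<^sub>i\<close> and \<open>x\<^sub>i\<close> to the same element
  if \<open>a\<close> and \<open>b\<close> first differ at \<open>i \<in> a\<close>. Then \<open>q\<^sub>a\<close> and \<open>q\<^sub>b\<close> lie in different cosets of \<open>H\<close>, so \<open>H\<close>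
  has index \<open>2^\<aleph>\<^sub>0\<close>.\<close>

section \<open>Generic tuples of permutations\<close>

text \<open>\<open>H\<close> may have uncountably many cosets, and uncountably many meager sets may
  cover the group, so the Baire category theorem does not show that \<open>H\<close> is non-meager.
  A perfect tree replaces it: two of its branches fall into one coset, and all quotients of branches
  lie in the given comeager set.

  Genericity is stated combinatorially, so that conjugacy is a back-and-forth between finite
  invariant sets and category enters only in the choice of the next member of a tuple. Tuples of
  every finite length are needed because a conjugator introduced at some level must commute with all
  earlier choices on its branch; otherwise the relations already achieved are lost. It must also be
  the identity on a given finite set, or the infinite product would not converge. Hence conjugacy is
  needed over finite invariant sets, and new choices are taken in their stabilizers.

  The combinatorial input is Hrushovski's extension theorem for finite graphs in its clique-free
  form. It makes finite orbits dense, and so provides the finite invariant sets on which everything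
  rests.\<close>

abbreviation pinv :: "('a \<Rightarrow> 'b) \<Rightarrow> 'b \<Rightarrow> 'a" where
  "pinv f \<equiv> inv_into UNIV f"

lemma image_conjugate:
  assumes "g ` D = D" "\<And>x. x \<in> D \<Longrightarrow> q (g x) = h (q x)"
  shows "h ` q ` D = q ` D"
proof -
  have "h ` q ` D = q ` g ` D" using assms(2) by (simp add: image_image)
  then show ?thesis by (simp only: assms(1))
qed

text \<open>The strength of the last two assumptions lies in the order of their quantifiers: one
  \<open>C\<close> serves all partial maps on \<open>A\<close>, and one \<open>e\<close> serves all
  compatible pairs \<open>c\<close>, \<open>d\<close>, so a whole tuple can be extended or
  amalgamated at once. \<open>closed_G\<close> is closedness under pointwise convergence, and
  \<open>v\<close> covers every point that \<open>G\<close> moves.\<close>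

locale eppa_perm_group =
  fixes G :: "('a \<Rightarrow> 'a) set" and v :: "nat \<Rightarrow> 'a"
  assumes bij_G: "g \<in> G \<Longrightarrow> bij g"
    and id_G: "id \<in> G"
    and comp_G: "g \<in> G \<Longrightarrow> h \<in> G \<Longrightarrow> g \<circ> h \<in> G"
    and inv_G: "g \<in> G \<Longrightarrow> pinv g \<in> G"
    and support_G: "g \<in> G \<Longrightarrow> x \<notin> range v \<Longrightarrow> g x = x"
    and closed_G: "bij f \<Longrightarrow> (\<And>S. finite S \<Longrightarrow> \<exists>g\<in>G. \<forall>x\<in>S. g x = f x) \<Longrightarrow> f \<in> G"
    and eppa: "finite A \<Longrightarrow> \<exists>C. finite C \<and> A \<subseteq> C \<and>
      (\<forall>p\<in>G. \<forall>D. D \<subseteq> A \<and> p ` D \<subseteq> A \<longrightarrow> (\<exists>q\<in>G. (\<forall>x\<in>D. q x = p x) \<and> q ` C = C))"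
    and amalgamation: "finite C \<Longrightarrow> finite D \<Longrightarrow> B \<subseteq> C \<Longrightarrow> B \<subseteq> D \<Longrightarrow>
      \<exists>e\<in>G. (\<forall>x\<in>B. e x = x) \<and>
        (\<forall>c\<in>G. \<forall>d\<in>G. c ` C = C \<and> d ` D = D \<and> c ` B = B \<and> (\<forall>x\<in>B. c x = d x) \<longrightarrow>
           (\<exists>f\<in>G. (\<forall>x\<in>D. f x = d x) \<and> (\<forall>x\<in>C. f (e x) = e (c x))))"
begin

lemma inj_G: "g \<in> G \<Longrightarrow> g x = g y \<longleftrightarrow> x = y"
  using bij_G[of g] by (auto simp: bij_def inj_def)

lemma inv_G_left [simp]: "g \<in> G \<Longrightarrow> pinv g (g x) = x"
  using bij_G[of g] by (simp add: bij_is_inj)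

lemma inv_G_right [simp]: "g \<in> G \<Longrightarrow> g (pinv g x) = x"
  using bij_G[of g] by (simp add: bij_is_surj surj_f_inv_f)

text \<open>\<open>dom\<close> and \<open>ran\<close> are the two halves of a back-and-forth: they
  make the limit defined and onto on \<open>range v\<close>. A point in no \<open>C n\<close> lies
  outside \<open>range v\<close>, where every element of \<open>G\<close> is the identity; hence the
  agreement on arbitrary finite sets, and \<open>closed_G\<close> applies.\<close>

lemma limit_in_G:
  fixes p :: "nat \<Rightarrow> 'a \<Rightarrow> 'a" and C :: "nat \<Rightarrow> 'a set"
  assumes p: "\<And>n. p n \<in> G" and mono: "\<And>n. C n \<subseteq> C (Suc n)"
    and agree: "\<And>n x. x \<in> C n \<Longrightarrow> p (Suc n) x = p n x"
    and dom: "\<And>n. v n \<in> C n" and ran: "\<And>n. v n \<in> p n ` C n"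
  obtains q where "q \<in> G" "\<And>n x. x \<in> C n \<Longrightarrow> q x = p n x"
    "\<And>S. finite S \<Longrightarrow> \<exists>N. \<forall>n\<ge>N. \<forall>x\<in>S. q x = p n x"
proof -
  have monoC: "C m \<subseteq> C n" if "m \<le> n" for m n
    using that by (rule lift_Suc_mono_le[of C, OF mono])
  have stable: "p n x = p m x" if "m \<le> n" "x \<in> C m" for m n x
    using that
  proof (induction n rule: dec_induct)
    case (step n)
    then show ?case using agree[of x n] monoC[of m n] by auto
  qed simp
  define q where "q x = (if \<exists>n. x \<in> C n then p (SOME n. x \<in> C n) x else x)" for x
  have q: "q x = p n x" if "x \<in> C n" for n x
  proof -
    have "x \<in> C (SOME n. x \<in> C n)" using that by (rule someI)
    moreover have "q x = p (SOME n. x \<in> C n) x" using that by (auto simp: q_def)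
    ultimately show ?thesis using that stable by (metis nle_le)
  qed
  have ev: "\<exists>N. \<forall>n\<ge>N. q x = p n x" for x
  proof (cases "\<exists>n. x \<in> C n")
    case True
    then show ?thesis using q monoC by blast
  next
    case False
    then have "x \<notin> range v" using dom by auto
    then have "q x = p n x" for n using False support_G[OF p] by (simp add: q_def)
    then show ?thesis by blast
  qed
  have fin: "\<exists>N. \<forall>n\<ge>N. \<forall>x\<in>S. q x = p n x" if "finite S" for S
    using that
  proof induction
    case (insert x S)
    then obtain N where N: "\<forall>n\<ge>N. \<forall>x\<in>S. q x = p n x" by blast
    obtain M where "\<forall>n\<ge>M. q x = p n x" using ev by blast
    then show ?case using N by (intro exI[of _ "max M N"]) auto
  qed simp
  have "inj q"
  proof (rule injI)
    fix x y assume "q x = q y"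
    moreover obtain n where "\<forall>z\<in>{x,y}. q z = p n z" using fin[of "{x,y}"] by blast
    ultimately have "p n x = p n y" by simp
    then show "x = y" using inj_G[OF p] by simp
  qed
  moreover have "\<exists>x. y = q x" for y
  proof (cases "y \<in> range v")
    case True
    then obtain n where n: "y = v n" by blast
    then obtain x where "x \<in> C n" "p n x = y" using ran[of n] by auto
    then show ?thesis using q by metis
  next
    case False
    obtain n where "q y = p n y" using ev by blast
    then show ?thesis using support_G[OF p False] by metis
  qed
  ultimately have "bij q" by (simp add: bij_def surj_def)
  moreover have "\<exists>g\<in>G. \<forall>x\<in>S. g x = q x" if "finite S" for S
    using fin[OF that] p by (metis nle_le)
  ultimately have "q \<in> G" by (rule closed_G)
  then show ?thesis using that q fin by blast
qed

text \<open>A tuple \<open>g 0, \<dots>, g (n - 1)\<close> is generic if its orbits are finite and it realizes, over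
  every finite invariant set \<open>B\<close>, every finite extension \<open>C\<close> of its action on \<open>B\<close>. The values \<open>g i\<close>
  for \<open>i \<ge> n\<close> are irrelevant.\<close>

definition generic :: "nat \<Rightarrow> (nat \<Rightarrow> 'a \<Rightarrow> 'a) \<Rightarrow> bool" where
  "generic n g \<longleftrightarrow> (\<forall>i<n. g i \<in> G) \<and>
     (\<forall>S. finite S \<longrightarrow> (\<exists>T. finite T \<and> S \<subseteq> T \<and> (\<forall>i<n. g i ` T = T))) \<and>
     (\<forall>B C c. finite C \<and> B \<subseteq> C \<and>
        (\<forall>i<n. c i \<in> G \<and> c i ` C = C \<and> c i ` B = B \<and> (\<forall>x\<in>B. c i x = g i x)) \<longrightarrow>
        (\<exists>e\<in>G. (\<forall>x\<in>B. e x = x) \<and> (\<forall>i<n. \<forall>x\<in>C. e (c i x) = g i (e x))))"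

lemma generic_in_G: "generic n g \<Longrightarrow> i < n \<Longrightarrow> g i \<in> G"
  by (simp add: generic_def)

lemma generic_invariant_set:
  assumes "generic n g" "finite S"
  obtains T where "finite T" "S \<subseteq> T" "\<And>i. i < n \<Longrightarrow> g i ` T = T"
proof -
  have "\<exists>T. finite T \<and> S \<subseteq> T \<and> (\<forall>i<n. g i ` T = T)"
    by (rule assms(1)[unfolded generic_def, THEN conjunct2, THEN conjunct1, rule_format, OF assms(2)])
  then obtain T where "finite T \<and> S \<subseteq> T \<and> (\<forall>i<n. g i ` T = T)" by (rule exE)
  then show ?thesis using that[of T] by simp
qed

lemma generic_realize:
  assumes "generic n g" "finite C" "B \<subseteq> C"
    and "\<And>i. i < n \<Longrightarrow> c i \<in> G" "\<And>i. i < n \<Longrightarrow> c i ` C = C" "\<And>i. i < n \<Longrightarrow> c i ` B = B"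
    and "\<And>i x. i < n \<Longrightarrow> x \<in> B \<Longrightarrow> c i x = g i x"
  obtains e where "e \<in> G" "\<And>x. x \<in> B \<Longrightarrow> e x = x"
    "\<And>i x. i < n \<Longrightarrow> x \<in> C \<Longrightarrow> e (c i x) = g i (e x)"
proof -
  have "\<exists>e\<in>G. (\<forall>x\<in>B. e x = x) \<and> (\<forall>i<n. \<forall>x\<in>C. e (c i x) = g i (e x))"
    using assms(1)[unfolded generic_def, THEN conjunct2, THEN conjunct2, rule_format, of C B c]
      assms(2-) by (simp cong del: image_cong_simp)
  then show ?thesis using that by blast
qed

lemma generic_0: "generic 0 g"
proof -
  have "\<exists>e\<in>G. \<forall>x\<in>B. e x = x" for B using id_G by (intro bexI[of _ id]) auto
  then show ?thesis by (auto simp: generic_def)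
qed

lemma generic_cong: "(\<And>i. i < n \<Longrightarrow> g i = h i) \<Longrightarrow> generic n g = generic n h"
  by (simp add: generic_def)

text \<open>Points outside \<open>range v\<close> are fixed by all of \<open>G\<close>, so they can
  be cut off and added again freely. Testing only subsets of \<open>range v\<close> leaves countably
  many finite sets, as a category argument requires.\<close>

lemma genericI:
  assumes g: "\<And>i. i < n \<Longrightarrow> g i \<in> G"
    and inv: "\<And>S. finite S \<Longrightarrow> S \<subseteq> range v \<Longrightarrow> \<exists>T. finite T \<and> S \<subseteq> T \<and> (\<forall>i<n. g i ` T = T)"
    and real: "\<And>B C c. finite C \<Longrightarrow> C \<subseteq> range v \<Longrightarrow> B \<subseteq> C \<Longrightarrow>
        (\<forall>i<n. c i \<in> G \<and> c i ` C = C \<and> c i ` B = B \<and> (\<forall>x\<in>B. c i x = g i x)) \<Longrightarrow>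
        \<exists>e\<in>G. (\<forall>x\<in>B. e x = x) \<and> (\<forall>i<n. \<forall>x\<in>C. e (c i x) = g i (e x))"
  shows "generic n g"
proof -
  have img: "f ` (X \<inter> range v) = X \<inter> range v" if "f \<in> G" "f ` X = X" for f X
  proof -
    have "f x \<in> range v \<longleftrightarrow> x \<in> range v" for x
      using that(1) support_G inj_G by metis
    then have "f ` (X \<inter> range v) = f ` X \<inter> range v" by auto
    then show ?thesis using that(2) by simp
  qed
  have 1: "\<exists>T. finite T \<and> S \<subseteq> T \<and> (\<forall>i<n. g i ` T = T)" if "finite S" for S
  proof -
    have "finite (S \<inter> range v)" using that by simp
    then obtain T where T: "finite T" "S \<inter> range v \<subseteq> T" "\<forall>i<n. g i ` T = T"
      using inv[of "S \<inter> range v"] by blast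
    have "g i ` (T \<union> (S - range v)) = T \<union> (S - range v)" if "i < n" for i
    proof -
      have "g i ` (S - range v) = S - range v" using support_G[OF g[OF that]] by force
      then show ?thesis using T(3) that by (simp add: image_Un)
    qed
    then show ?thesis using T \<open>finite S\<close> by (intro exI[of _ "T \<union> (S - range v)"]) auto
  qed
  have 2: "\<exists>e\<in>G. (\<forall>x\<in>B. e x = x) \<and> (\<forall>i<n. \<forall>x\<in>C. e (c i x) = g i (e x))"
    if C: "finite C" "B \<subseteq> C" and
     c: "\<forall>i<n. c i \<in> G \<and> c i ` C = C \<and> c i ` B = B \<and> (\<forall>x\<in>B. c i x = g i x)" for B C c
  proof -
    have "\<exists>e\<in>G. (\<forall>x\<in>B \<inter> range v. e x = x) \<and> (\<forall>i<n. \<forall>x\<in>C \<inter> range v. e (c i x) = g i (e x))"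
    proof (rule real)
      show "\<forall>i<n. c i \<in> G \<and> c i ` (C \<inter> range v) = C \<inter> range v \<and>
          c i ` (B \<inter> range v) = B \<inter> range v \<and> (\<forall>x\<in>B \<inter> range v. c i x = g i x)"
        using c img by (simp cong del: image_cong_simp)
    qed (use C in auto)
    then obtain e where e: "e \<in> G" "\<forall>x\<in>B \<inter> range v. e x = x"
      "\<forall>i<n. \<forall>x\<in>C \<inter> range v. e (c i x) = g i (e x)" by blast
    have "e (c i x) = g i (e x)" if "i < n" "x \<in> C" for i x
    proof (cases "x \<in> range v")
      case False
      then have "c i x = x" "g i x = x" "e x = x"
        using support_G e(1) c g that(1) by auto
      then show ?thesis by simp
    qed (use e that in auto)
    moreover have "e x = x" if "x \<in> B" for x
      using e that support_G by (cases "x \<in> range v") auto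
    ultimately show ?thesis using e(1) by blast
  qed
  show ?thesis
    unfolding generic_def by (intro conjI allI impI) (rule g 1 2; simp cong del: image_cong_simp)+
qed

text \<open>Transport by \<open>p\<close> turns the action of \<open>g\<close> on \<open>D\<close>
  into one on the image of \<open>D\<close>, and this extends the action of \<open>h\<close> on the
  image of \<open>C\<close>. Genericity of \<open>h\<close> realizes the extension by some
  \<open>e\<close> over the image of \<open>C\<close>; then \<open>e \<circ> p\<close> is as
  wanted.\<close>

lemma extend_conjugacy:
  assumes h: "generic n h" and g: "\<And>i. i < n \<Longrightarrow> g i \<in> G" and p: "p \<in> G"
    and D: "finite D" "C \<subseteq> D"
    and inv: "\<And>i. i < n \<Longrightarrow> g i ` C = C" "\<And>i. i < n \<Longrightarrow> g i ` D = D"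
    and conj: "\<And>i x. i < n \<Longrightarrow> x \<in> C \<Longrightarrow> p (g i x) = h i (p x)"
  obtains q where "q \<in> G" "\<And>x. x \<in> C \<Longrightarrow> q x = p x"
    "\<And>i x. i < n \<Longrightarrow> x \<in> D \<Longrightarrow> q (g i x) = h i (q x)"
proof -
  define c where "c i = p \<circ> g i \<circ> pinv p" for i
  have im: "c i ` (p ` X) = p ` (g i ` X)" for i X
    using p by (force simp: c_def)
  obtain e where e: "e \<in> G" "\<And>x. x \<in> p ` C \<Longrightarrow> e x = x"
    "\<And>i x. i < n \<Longrightarrow> x \<in> p ` D \<Longrightarrow> e (c i x) = h i (e x)"
  proof (rule generic_realize[OF h, of "p ` D" "p ` C" c])
    show "c i \<in> G" if "i < n" for i
      using g[OF that] p by (simp add: c_def comp_G inv_G)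
    show "c i x = h i x" if "i < n" "x \<in> p ` C" for i x
      using that p conj by (auto simp: c_def)
  qed (use D inv im in auto)
  show ?thesis
  proof (rule that[of "e \<circ> p"])
    show "(e \<circ> p) (g i x) = h i ((e \<circ> p) x)" if "i < n" "x \<in> D" for i x
      using e(3)[of i "p x"] that p by (simp add: c_def)
  qed (use e p comp_G in auto)
qed

lemma generic_conjugate:
  assumes g: "generic n g" and h: "generic n h" and B: "finite B"
    and inv: "\<And>i. i < n \<Longrightarrow> g i ` B = B" and eq: "\<And>i x. i < n \<Longrightarrow> x \<in> B \<Longrightarrow> g i x = h i x"
  obtains k where "k \<in> G" "\<And>x. x \<in> B \<Longrightarrow> k x = x" "\<And>i. i < n \<Longrightarrow> k \<circ> g i = h i \<circ> k"
proof -
  define P where "P n' s \<longleftrightarrow> (case s of (p, C) \<Rightarrow> p \<in> G \<and> finite C \<and> B \<subseteq> C \<and> (\<forall>x\<in>B. p x = x) \<and>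
      (\<forall>i<n. g i ` C = C \<and> (\<forall>x\<in>C. p (g i x) = h i (p x))) \<and>
      (\<forall>j<n'. v j \<in> C \<and> v j \<in> p ` C))" for n' :: nat and s
  define Q where "Q n' s s' \<longleftrightarrow> (case (s, s') of ((p, C), (q, D)) \<Rightarrow>
      C \<subseteq> D \<and> (\<forall>x\<in>C. q x = p x))" for n' :: nat and s s' :: "('a \<Rightarrow> 'a) \<times> 'a set"
  have "\<exists>f. \<forall>n'. P n' (f n') \<and> Q n' (f n') (f (Suc n'))"
  proof (rule dependent_nat_choice)
    show "\<exists>x. P 0 x"
      by (rule exI[of _ "(id, B)"]) (use id_G B inv eq in \<open>auto simp: P_def\<close>)
  next
    fix s n' assume "P n' s"
    then obtain p C where s: "s = (p, C)" and p: "p \<in> G" and C: "finite C" "B \<subseteq> C"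
      and pB: "\<forall>x\<in>B. p x = x" and gC: "\<And>i. i < n \<Longrightarrow> g i ` C = C"
      and conj: "\<And>i x. i < n \<Longrightarrow> x \<in> C \<Longrightarrow> p (g i x) = h i (p x)"
      and vj: "\<forall>j<n'. v j \<in> C \<and> v j \<in> p ` C"
      unfolding P_def by (cases s) auto
    obtain D where D: "finite D" "C \<union> {v n'} \<subseteq> D" "\<And>i. i < n \<Longrightarrow> g i ` D = D"
      using generic_invariant_set[OF g, of "C \<union> {v n'}"] C by auto
    obtain q where q: "q \<in> G" "\<And>x. x \<in> C \<Longrightarrow> q x = p x"
      "\<And>i x. i < n \<Longrightarrow> x \<in> D \<Longrightarrow> q (g i x) = h i (q x)"
      by (rule extend_conjugacy[where n = n and g = g and h = h and p = p and C = C and D = D])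
        (use h generic_in_G[OF g] p D gC conj in simp_all)
    have hqD: "h i ` (q ` D) = q ` D" if "i < n" for i
      by (rule image_conjugate[where g = "g i"]) (use D(3) q(3) that in simp_all)
    obtain D' where D': "finite D'" "q ` D \<union> {v n'} \<subseteq> D'" "\<And>i. i < n \<Longrightarrow> h i ` D' = D'"
      using generic_invariant_set[OF h, of "q ` D \<union> {v n'}"] D by auto
    \<comment> \<open>The back half: the same extension for the inverse conjugacy, from
      \<open>h\<close> to \<open>g\<close>, brings \<open>v n'\<close> into the range. The next
      stage is the inverse of \<open>r\<close>.\<close>
    obtain r where r: "r \<in> G" "\<And>x. x \<in> q ` D \<Longrightarrow> r x = pinv q x"
      "\<And>i x. i < n \<Longrightarrow> x \<in> D' \<Longrightarrow> r (h i x) = g i (r x)"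
    proof (rule extend_conjugacy[where n = n and g = h and h = g and p = "pinv q" and C = "q ` D" and D = D'])
      show "pinv q (h i x) = g i (pinv q x)" if "i < n" "x \<in> q ` D" for i x
        using that q(3)[OF that(1), symmetric] q(1) by auto
    qed (use g generic_in_G[OF h] q(1) inv_G D' hqD in simp_all)
    have rD: "pinv r x = q x" "x \<in> r ` D'" if "x \<in> D" for x
    proof -
      have "r (q x) = x" using r(2)[of "q x"] that q(1) by simp
      then show "pinv r x = q x" "x \<in> r ` D'" using r(1) D'(2) that by (metis inv_G_left, force)
    qed
    have grD: "g i ` (r ` D') = r ` D'" if "i < n" for i
      by (rule image_conjugate[where g = "h i"]) (use D'(3) r(3) that in simp_all)
    have "P (Suc n') (pinv r, r ` D')"
      unfolding P_def
    proof (clarify, intro conjI allI impI ballI)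
      show "pinv r x = x" if "x \<in> B" for x
      proof -
        have "x \<in> C" "x \<in> D" using that C D(2) by auto
        then show ?thesis using that rD(1) q(2) pB by simp
      qed
      show "pinv r (g i x) = h i (pinv r x)" if "i < n" "x \<in> r ` D'" for i x
        using that r(3)[OF that(1), symmetric] r(1) by auto
      show "B \<subseteq> r ` D'" using rD(2) C D by auto
      show "v j \<in> r ` D'" "v j \<in> pinv r ` r ` D'" if "j < Suc n'" for j
      proof -
        have "v j \<in> D" using that vj D(2) by (cases "j = n'") auto
        then show "v j \<in> r ` D'" by (rule rD)
        have "v j \<in> D'"
        proof (cases "j = n'")
          case False
          then have "v j \<in> p ` C" using vj that by auto
          then have "v j \<in> q ` D" using q(2) D(2) by force
          then show ?thesis using D'(2) by auto
        qed (use D' in auto)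
        then show "v j \<in> pinv r ` r ` D'" using r(1) by (simp add: image_image)
      qed
    qed (use r inv_G D' grD in auto)
    moreover have "Q n' s (pinv r, r ` D')"
      using rD D(2) q(2) by (auto simp: Q_def s)
    ultimately show "\<exists>y. P (Suc n') y \<and> Q n' s y" by blast
  qed
  then obtain f where f: "\<And>n'. P n' (f n')" "\<And>n'. Q n' (f n') (f (Suc n'))" by blast
  \<comment> \<open>Stage \<open>n'\<close> only covers the points \<open>v j\<close> with
    \<open>j < n'\<close>, while \<open>limit_in_G\<close> wants \<open>v j\<close> at index
    \<open>j\<close>; hence the shift by one.\<close>
  define p where "p j = fst (f (Suc j))" for j
  define C where "C j = snd (f (Suc j))" for j
  have P: "P (Suc j) (p j, C j)" for j using f(1)[of "Suc j"] by (simp add: p_def C_def)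
  have Q: "Q (Suc j) (p j, C j) (p (Suc j), C (Suc j))" for j
    using f(2)[of "Suc j"] by (simp add: p_def C_def)
  obtain k where k: "k \<in> G" "\<And>j x. x \<in> C j \<Longrightarrow> k x = p j x"
    by (rule limit_in_G[of p C]) (use P Q in \<open>auto simp: P_def Q_def\<close>)
  show ?thesis
  proof (rule that[OF k(1)])
    show "k x = x" if "x \<in> B" for x
    proof -
      have "x \<in> C 0" "p 0 x = x" using P[of 0] that by (auto simp: P_def)
      then show ?thesis using k(2) by metis
    qed
    show "k \<circ> g i = h i \<circ> k" if i: "i < n" for i
    proof
      fix x
      show "(k \<circ> g i) x = (h i \<circ> k) x"
      proof (cases "x \<in> range v")
        case True
        then obtain j where "x = v j" by blast
        then have x: "x \<in> C j" using P[of j] by (simp add: P_def)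
        moreover have "g i ` C j = C j" "p j (g i x) = h i (p j x)"
          using x P[of j] i by (simp_all add: P_def)
        then have "g i x \<in> C j" using x by blast
        note this \<open>p j (g i x) = h i (p j x)\<close>
        ultimately show ?thesis using k(2)[of x j] k(2)[of "g i x" j] by simp
      next
        case False
        then have "g i x = x" "h i x = x" "k x = x"
          using support_G k(1) generic_in_G[OF g i] generic_in_G[OF h i] by auto
        then show ?thesis by simp
      qed
    qed
  qed
qed

end

section \<open>Extending a generic tuple is a comeager condition\<close>

lemma countable_PiE_finite:
  "finite I \<Longrightarrow> (\<And>i. i \<in> I \<Longrightarrow> countable (F i)) \<Longrightarrow> countable (Pi\<^sub>E I F)"
  by (induction I rule: finite_induct) (auto simp: PiE_insert_eq)

context eppa_perm_group begin

definition stab :: "'a set \<Rightarrow> ('a \<Rightarrow> 'a) set" where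
  "stab A = {g \<in> G. \<forall>x\<in>A. g x = x}"

text \<open>The two conjuncts are openness and density relative to \<open>stab A\<close>, in the
  topology of pointwise convergence. \<open>D\<close> may contain anything outside
  \<open>stab A\<close>.\<close>

definition dense_open :: "'a set \<Rightarrow> ('a \<Rightarrow> 'a) set \<Rightarrow> bool" where
  "dense_open A D \<longleftrightarrow>
     (\<forall>x \<in> stab A \<inter> D. \<exists>S. finite S \<and> (\<forall>y \<in> stab A. (\<forall>z\<in>S. y z = x z) \<longrightarrow> y \<in> D)) \<and>
     (\<forall>x \<in> stab A. \<forall>S. finite S \<longrightarrow> (\<exists>y \<in> stab A \<inter> D. \<forall>z\<in>S. y z = x z))"

text \<open>Density of having finite invariant sets. The extension property completes
  \<open>x\<close> on \<open>S\<close> and the members of \<open>g\<close> on an invariant set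
  \<open>D\<close> to permutations of one finite \<open>C\<close>. Genericity then moves
  \<open>C\<close>, over \<open>D\<close>, to a place where the completions of the
  \<open>g i\<close> are the \<open>g i\<close> themselves. As \<open>D\<close> contains
  \<open>S\<close> and its image under \<open>x\<close>, this move preserves the values on
  \<open>S\<close>.\<close>

lemma extend_invariant:
  assumes g: "generic n g" and x: "x \<in> G" and S: "finite S"
  obtains y T where "y \<in> G" "\<And>z. z \<in> S \<Longrightarrow> y z = x z" "finite T" "S \<subseteq> T" "y ` T = T"
    "\<And>i. i < n \<Longrightarrow> g i ` T = T"
proof -
  obtain D where D: "finite D" "S \<union> x ` S \<subseteq> D" "\<And>i. i < n \<Longrightarrow> g i ` D = D"
    using generic_invariant_set[OF g, of "S \<union> x ` S"] S by auto
  obtain C where C: "finite C" "D \<subseteq> C"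
    and ext: "\<forall>p\<in>G. \<forall>D'. D' \<subseteq> D \<and> p ` D' \<subseteq> D \<longrightarrow>
      (\<exists>q\<in>G. (\<forall>x\<in>D'. q x = p x) \<and> q ` C = C)"
    using eppa[OF D(1)] by (elim exE conjE) simp
  have "\<exists>q\<in>G. (\<forall>x\<in>D. q x = g i x) \<and> q ` C = C" if "i < n" for i
    using ext[rule_format, of "g i" D] generic_in_G[OF g that] D(3)[OF that] by simp
  then obtain c where c: "\<And>i. i < n \<Longrightarrow> c i \<in> G" "\<And>i. i < n \<Longrightarrow> c i ` C = C"
    "\<And>i z. i < n \<Longrightarrow> z \<in> D \<Longrightarrow> c i z = g i z"
    by metis
  have cD: "c i ` D = D" if "i < n" for i
    using c(3)[OF that] D(3)[OF that] by simp
  obtain e where e: "e \<in> G" "\<And>z. z \<in> D \<Longrightarrow> e z = z"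
    "\<And>i z. i < n \<Longrightarrow> z \<in> C \<Longrightarrow> e (c i z) = g i (e z)"
    by (rule generic_realize[where n = n and g = g and c = c and C = C and B = D])
      (use g C c cD in simp_all)
  obtain y where y: "y \<in> G" "\<And>z. z \<in> S \<Longrightarrow> y z = x z" "y ` C = C"
    using ext[rule_format, of x S] x D(2) by auto
  show ?thesis
  proof (rule that[of "e \<circ> y \<circ> pinv e" "e ` C"])
    show "e \<circ> y \<circ> pinv e \<in> G" using e(1) y(1) comp_G inv_G by simp
    show "(e \<circ> y \<circ> pinv e) z = x z" if "z \<in> S" for z
    proof -
      have "z \<in> D" "x z \<in> D" using that D(2) by auto
      then show ?thesis using e y(2)[OF that] inv_G_left[OF e(1), of z] by simp
    qed
    show "finite (e ` C)" using C by simp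
    show "S \<subseteq> e ` C"
    proof
      fix z assume "z \<in> S"
      then have "z \<in> D" using D(2) by auto
      then show "z \<in> e ` C" using e(2)[of z] C(2) by (metis image_eqI subsetD)
    qed
    show "(e \<circ> y \<circ> pinv e) ` e ` C = e ` C"
      by (rule image_conjugate[where g = y]) (use y(3) e(1) in auto)
    show "g i ` e ` C = e ` C" if "i < n" for i
      by (rule image_conjugate[where g = "c i"]) (use c(2) e(3) that in simp_all)
  qed
qed

text \<open>Density of realizing the extension \<open>C\<close> of the action on \<open>B\<close>.
  Amalgamation puts a copy of \<open>C\<close> beside \<open>T\<close> over \<open>B\<close> so that
  all \<open>n + 1\<close> maps act on the union. By genericity of \<open>g\<close> the first
  \<open>n\<close> may be taken to be \<open>g\<close> itself; the last one becomes the new member,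
  which still agrees with \<open>x\<close> on \<open>T\<close>.\<close>

lemma extend_realize:
  assumes g: "generic n g" and x: "x \<in> G" and T: "finite T" "x ` T = T" "\<And>i. i < n \<Longrightarrow> g i ` T = T"
    and BC: "finite C" "B \<subseteq> C" "B \<subseteq> T"
    and c: "\<And>i. i \<le> n \<Longrightarrow> c i \<in> G" "\<And>i. i \<le> n \<Longrightarrow> c i ` C = C" "\<And>i. i \<le> n \<Longrightarrow> c i ` B = B"
      "\<And>i z. i < n \<Longrightarrow> z \<in> B \<Longrightarrow> c i z = g i z" "\<And>z. z \<in> B \<Longrightarrow> c n z = x z"
  obtains y e where "y \<in> G" "\<And>z. z \<in> T \<Longrightarrow> y z = x z" "e \<in> G" "\<And>z. z \<in> B \<Longrightarrow> e z = z"
    "\<And>i z. i < n \<Longrightarrow> z \<in> C \<Longrightarrow> e (c i z) = g i (e z)" "\<And>z. z \<in> C \<Longrightarrow> e (c n z) = y (e z)"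
proof -
  obtain e0 where e0: "e0 \<in> G" "\<And>z. z \<in> B \<Longrightarrow> e0 z = z"
    and am: "\<forall>c\<in>G. \<forall>d\<in>G. c ` C = C \<and> d ` T = T \<and> c ` B = B \<and> (\<forall>x\<in>B. c x = d x) \<longrightarrow>
      (\<exists>f\<in>G. (\<forall>x\<in>T. f x = d x) \<and> (\<forall>x\<in>C. f (e0 x) = e0 (c x)))"
    using amalgamation[OF BC(1) T(1) BC(2,3)] by (elim bexE conjE) simp
  have "\<exists>f\<in>G. (\<forall>x\<in>T. f x = g i x) \<and> (\<forall>x\<in>C. f (e0 x) = e0 (c i x))" if "i < n" for i
    using am[rule_format, of "c i" "g i"] c that generic_in_G[OF g that] T(3)[OF that]
    by (simp cong del: image_cong_simp)
  then obtain f where f: "\<And>i. i < n \<Longrightarrow> f i \<in> G" "\<And>i z. i < n \<Longrightarrow> z \<in> T \<Longrightarrow> f i z = g i z"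
    "\<And>i z. i < n \<Longrightarrow> z \<in> C \<Longrightarrow> f i (e0 z) = e0 (c i z)"
    by metis
  obtain y0 where y0: "y0 \<in> G" "\<And>z. z \<in> T \<Longrightarrow> y0 z = x z" "\<And>z. z \<in> C \<Longrightarrow> y0 (e0 z) = e0 (c n z)"
  proof -
    have "\<exists>f\<in>G. (\<forall>z\<in>T. f z = x z) \<and> (\<forall>z\<in>C. f (e0 z) = e0 (c n z))"
      using am[rule_format, of "c n" x] c x T(2) by (simp cong del: image_cong_simp)
    then show ?thesis using that by blast
  qed
  have fT: "f i ` T = T" if "i < n" for i using f(2)[OF that] T(3)[OF that] by simp
  have fC: "f i ` e0 ` C = e0 ` C" if "i < n" for i
    by (rule image_conjugate[where g = "c i"]) (use c(2) f(3) that in simp_all)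
  obtain e where e: "e \<in> G" "\<And>z. z \<in> T \<Longrightarrow> e z = z"
    "\<And>i z. i < n \<Longrightarrow> z \<in> T \<union> e0 ` C \<Longrightarrow> e (f i z) = g i (e z)"
    by (rule generic_realize[where n = n and g = g and c = f and C = "T \<union> e0 ` C" and B = T])
      (use g BC(1) T(1) f fT fC in \<open>simp_all add: image_Un\<close>)
  show ?thesis
  proof (rule that[of "e \<circ> y0 \<circ> pinv e" "e \<circ> e0"])
    show "(e \<circ> y0 \<circ> pinv e) z = x z" if "z \<in> T" for z
    proof -
      have "x z \<in> T" using that T(2) by blast
      then show ?thesis using e(1,2) that y0(2) inv_G_left[OF e(1), of z] by simp
    qed
    show "(e \<circ> e0) (c i z) = g i ((e \<circ> e0) z)" if "i < n" "z \<in> C" for i z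
      using that e(3)[of i "e0 z"] f(3) by simp
    show "(e \<circ> e0) (c n z) = (e \<circ> y0 \<circ> pinv e) ((e \<circ> e0) z)" if "z \<in> C" for z
      using that e(1) y0(3) by simp
    show "(e \<circ> e0) z = z" if "z \<in> B" for z
      using that e(2)[of z] e0(2) BC(3) by auto
  qed (use e(1) e0(1) y0(1) comp_G inv_G in simp_all)
qed

lemma range_v_invariant: "g \<in> G \<Longrightarrow> g x \<in> range v \<longleftrightarrow> x \<in> range v"
  using support_G[of g] inj_G[of g] by metis

lemma countable_dense_subset:
  obtains G0 where "G0 \<subseteq> G" "countable G0"
    "\<And>g S. g \<in> G \<Longrightarrow> finite S \<Longrightarrow> \<exists>h\<in>G0. \<forall>x\<in>S. h x = g x"
proof -
  define K where "K = (SIGMA S:{S. finite S \<and> S \<subseteq> range v}. S \<rightarrow>\<^sub>E range v)"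
  define rep where "rep = (\<lambda>(S, r). SOME g. g \<in> G \<and> (\<forall>x\<in>S. g x = r x))"
  have "countable K" unfolding K_def
    by (intro countable_SIGMA countable_Collect_finite_subset countable_PiE_finite) auto
  have rep: "rep (S, restrict g S) \<in> G \<and> (\<forall>x\<in>S. rep (S, restrict g S) x = g x)" if "g \<in> G" for g S
  proof -
    have "\<exists>h. h \<in> G \<and> (\<forall>x\<in>S. h x = restrict g S x)" using that by auto
    from someI_ex[OF this] show ?thesis unfolding rep_def by simp
  qed
  show ?thesis
  \<comment> \<open>\<open>K\<close> also contains partial maps that no element of \<open>G\<close>
    induces. There the choice in \<open>rep\<close> is arbitrary, hence the intersection with
    \<open>G\<close>.\<close>
  proof (rule that[of "G \<inter> rep ` K"])
    show "countable (G \<inter> rep ` K)" using \<open>countable K\<close> by auto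
    fix g S assume g: "g \<in> G" and S: "finite (S :: 'a set)"
    let ?S = "S \<inter> range v"
    have "(?S, restrict g ?S) \<in> K" using S range_v_invariant[OF g] by (auto simp: K_def)
    then have "rep (?S, restrict g ?S) \<in> G \<inter> rep ` K" using rep[OF g] by blast
    moreover have "\<forall>x\<in>S. rep (?S, restrict g ?S) x = g x"
      using rep[OF g, of ?S] support_G[OF g] support_G[of "rep (?S, restrict g ?S)"] by (metis IntI)
    ultimately show "\<exists>h\<in>G \<inter> rep ` K. \<forall>x\<in>S. h x = g x" by blast
  qed auto
qed

text \<open>Each requirement on the new member involves finite sets of points and a tuple of maps on
  them. Only the values of these maps there matter, so they may be taken from a countable dense
  subset of \<open>G\<close>, and countably many requirements remain.\<close>

lemma generic_extend_comeager:
  assumes g: "generic n g" and A: "finite A"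
  obtains \<D> where "countable \<D>" "\<And>D. D \<in> \<D> \<Longrightarrow> dense_open A D"
    "\<And>x. x \<in> stab A \<Longrightarrow> x \<in> \<Inter>\<D> \<Longrightarrow> generic (Suc n) (g(n := x))"
proof -
  obtain G0 where G0: "G0 \<subseteq> G" "countable G0"
    "\<And>g S. g \<in> G \<Longrightarrow> finite S \<Longrightarrow> \<exists>h\<in>G0. \<forall>x\<in>S. h x = g x"
    using countable_dense_subset by blast
  define F where "F = {S. finite S \<and> S \<subseteq> range v}"
  have cF: "countable F" unfolding F_def by (rule countable_Collect_finite_subset) simp
  define I where "I T x \<longleftrightarrow> finite T \<and> x ` T = T \<and> (\<forall>i<n. g i ` T = T)" for T x
  define D1 where "D1 S = {x. \<exists>T. S \<subseteq> T \<and> I T x}" for S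
  define valid where "valid = (\<lambda>B C c. finite C \<and> B \<subseteq> C \<and>
      (\<forall>i\<le>n. c i \<in> G \<and> c i ` C = C \<and> c i ` B = B) \<and> (\<forall>i<n. \<forall>z\<in>B. c i z = g i z))"
  \<comment> \<open>An implication, so that density is possible: an \<open>x\<close> that violates
    the premise meets the requirement. Premise and conclusion are each decided by finitely many
    values of \<open>x\<close>, which makes both cases open.\<close>
  define D2 where "D2 = (\<lambda>(B, C, c). {x. valid B C c \<and> (\<forall>z\<in>B. c n z = x z) \<longrightarrow>
      (\<exists>e\<in>G. (\<forall>z\<in>B. e z = z) \<and> (\<forall>i<n. \<forall>z\<in>C. e (c i z) = g i (e z)) \<and>
        (\<forall>z\<in>C. e (c n z) = x (e z)))})"
  define \<D> where "\<D> = D1 ` F \<union> D2 ` (F \<times> F \<times> ({..n} \<rightarrow>\<^sub>E G0))"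
  have "countable ({..n} \<rightarrow>\<^sub>E G0)" using G0(2) by (intro countable_PiE_finite) auto
  then have "countable \<D>"
    unfolding \<D>_def using cF by (intro countable_Un countable_image countable_SIGMA) auto
  moreover have "dense_open A D" if D: "D \<in> \<D>" for D
  proof -
    consider S where "finite S" "D = D1 S" | B C c where "finite C" "D = D2 (B, C, c)"
      using D by (auto simp: \<D>_def F_def)
    then show ?thesis
    proof cases
      case 1
      have "\<exists>S. finite S \<and> (\<forall>y \<in> stab A. (\<forall>z\<in>S. y z = x z) \<longrightarrow> y \<in> D)" if xD: "x \<in> D" for x
      proof -
        obtain T where T: "S \<subseteq> T" "I T x"
          using xD unfolding 1(2) D1_def by blast
        have "y \<in> D" if "\<forall>z\<in>T. y z = x z" for y
        proof -
          have "I T y" using that T(2) by (simp add: I_def)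
          then show ?thesis using T(1) unfolding 1 D1_def by blast
        qed
        moreover have "finite T" using T(2) by (simp add: I_def)
        ultimately show ?thesis by blast
      qed
      moreover have "\<exists>y \<in> stab A \<inter> D. \<forall>z\<in>S'. y z = x z" if x: "x \<in> stab A" and S': "finite S'" for x S'
      proof -
        have "x \<in> G" using x by (simp add: stab_def)
        moreover have "finite (A \<union> S \<union> S')" using 1 A S' by simp
        ultimately obtain y T where y: "y \<in> G" "\<And>z. z \<in> A \<union> S \<union> S' \<Longrightarrow> y z = x z" "finite T"
          "A \<union> S \<union> S' \<subseteq> T" "y ` T = T" "\<And>i. i < n \<Longrightarrow> g i ` T = T"
          using extend_invariant[OF g] by metis
        have "I T y" using y(3,5,6) by (simp add: I_def)
        then have "y \<in> D" using y(4) unfolding 1 D1_def by blast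
        moreover have "y \<in> stab A" using x y(1,2) by (simp add: stab_def)
        ultimately show ?thesis using y(2) by blast
      qed
      ultimately show ?thesis unfolding dense_open_def by blast
    next
      case 2
      have "\<exists>S. finite S \<and> (\<forall>y \<in> stab A. (\<forall>z\<in>S. y z = x z) \<longrightarrow> y \<in> D)" if xD: "x \<in> D" for x
      proof (cases "valid B C c \<and> (\<forall>z\<in>B. c n z = x z)")
        case True
        then obtain e where e: "e \<in> G" "\<forall>z\<in>B. e z = z" "\<forall>i<n. \<forall>z\<in>C. e (c i z) = g i (e z)"
          "\<forall>z\<in>C. e (c n z) = x (e z)"
          using xD unfolding 2(2) D2_def by auto
        have "y \<in> D" if "\<forall>z\<in>e ` C. y z = x z" for y
          using that e unfolding 2 D2_def by auto
        then show ?thesis using 2 by (intro exI[of _ "e ` C"]) auto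
      next
        case False
        have "y \<in> D" if y: "\<forall>z\<in>B \<inter> C. y z = x z" for y
        proof -
          have "B \<subseteq> C" if "valid B C c" using that by (simp add: valid_def)
          then have "\<not> (valid B C c \<and> (\<forall>z\<in>B. c n z = y z))" using y False by fastforce
          then show ?thesis unfolding 2(2) D2_def by blast
        qed
        then show ?thesis using 2 by (intro exI[of _ "B \<inter> C"]) auto
      qed
      moreover have "\<exists>y \<in> stab A \<inter> D. \<forall>z\<in>S. y z = x z" if x: "x \<in> stab A" and S: "finite S" for x S
      proof -
        have "x \<in> G" using x by (simp add: stab_def)
        moreover have "finite (A \<union> C \<union> S)" using 2 A S by simp
        \<comment> \<open>\<open>extend_realize\<close> amalgamates with an invariant set, so
          \<open>x\<close> first receives one. It contains \<open>A\<close>, \<open>C\<close> and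
          \<open>S\<close>, hence the second correction leaves the values there alone.\<close>
        ultimately obtain x' T where x': "x' \<in> G" "\<And>z. z \<in> A \<union> C \<union> S \<Longrightarrow> x' z = x z" "finite T"
          "A \<union> C \<union> S \<subseteq> T" "x' ` T = T" "\<And>i. i < n \<Longrightarrow> g i ` T = T"
          using extend_invariant[OF g] by metis
        have x'A: "x' \<in> stab A" using x x'(1,2) by (simp add: stab_def)
        show ?thesis
        proof (cases "valid B C c \<and> (\<forall>z\<in>B. c n z = x' z)")
          case True
          then have BC: "finite C" "B \<subseteq> C" "B \<subseteq> T" using x'(4) by (auto simp: valid_def)
          obtain y e where y: "y \<in> G" "\<And>z. z \<in> T \<Longrightarrow> y z = x' z" "e \<in> G" "\<And>z. z \<in> B \<Longrightarrow> e z = z"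
            "\<And>i z. i < n \<Longrightarrow> z \<in> C \<Longrightarrow> e (c i z) = g i (e z)" "\<And>z. z \<in> C \<Longrightarrow> e (c n z) = y (e z)"
            by (rule extend_realize[where n = n and g = g and x = x' and T = T and B = B and C = C and c = c])
              (use g x' BC True in \<open>simp_all add: valid_def\<close>)
          have "y \<in> D" unfolding 2(2) D2_def using y(3-6) by blast
          moreover have "y \<in> stab A" using x'A y(1,2) x'(4) by (auto simp: stab_def)
          moreover have "\<forall>z\<in>S. y z = x z" using y(2) x'(2,4) by auto
          ultimately show ?thesis by blast
        next
          case False
          then have "x' \<in> D" unfolding 2 D2_def by auto
          then show ?thesis using x'A x'(2) by blast
        qed
      qed
      ultimately show ?thesis unfolding dense_open_def by blast
    qed
  qed
  moreover have "generic (Suc n) (g(n := x))" if x: "x \<in> stab A" and xD: "x \<in> \<Inter>\<D>" for x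
  proof (rule genericI)
    show "(g(n := x)) i \<in> G" if "i < Suc n" for i
      using that x generic_in_G[OF g] by (auto simp: stab_def)
    show "\<exists>T. finite T \<and> S \<subseteq> T \<and> (\<forall>i<Suc n. (g(n := x)) i ` T = T)"
      if "finite S" "S \<subseteq> range v" for S
    proof -
      have "x \<in> D1 S" using that xD by (auto simp: \<D>_def F_def)
      then obtain T where T: "S \<subseteq> T" "I T x" unfolding D1_def by blast
      then have "\<forall>i<Suc n. (g(n := x)) i ` T = T" by (simp add: I_def less_Suc_eq)
      then show ?thesis using T by (intro exI[of _ T]) (simp add: I_def)
    qed
    fix B C c assume C: "finite C" "C \<subseteq> range v" "B \<subseteq> C"
      and c: "\<forall>i<Suc n. c i \<in> G \<and> c i ` C = C \<and> c i ` B = B \<and> (\<forall>z\<in>B. c i z = (g(n := x)) i z)"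
    have "\<exists>h\<in>G0. \<forall>z\<in>C. h z = c i z" if "i \<le> n" for i
      using c that C(1) G0(3)[of "c i" C] by auto
    then obtain h where h: "\<And>i. i \<le> n \<Longrightarrow> h i \<in> G0" "\<And>i z. i \<le> n \<Longrightarrow> z \<in> C \<Longrightarrow> h i z = c i z"
      by metis
    define k where "k = restrict h {..n}"
    have k: "k \<in> {..n} \<rightarrow>\<^sub>E G0" "\<And>i z. i \<le> n \<Longrightarrow> z \<in> C \<Longrightarrow> k i z = c i z"
      using h by (auto simp: k_def)
    have im: "k i ` X = c i ` X" if "i \<le> n" "X \<subseteq> C" for i X
      using k(2) that by (intro image_cong) auto
    have "valid B C k"
      unfolding valid_def
    proof (intro conjI allI impI ballI)
      show "k i \<in> G" if "i \<le> n" for i using k(1) G0(1) that by (auto simp: PiE_def Pi_def)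
      show "k i ` C = C" "k i ` B = B" if "i \<le> n" for i
        using that im[OF that] C(3) c by (simp_all cong del: image_cong_simp)
      show "k i z = g i z" if "i < n" "z \<in> B" for i z
      proof -
        have "z \<in> C" using that C(3) by auto
        then show ?thesis using k(2)[of i z] c that by simp
      qed
    qed (use C in auto)
    moreover have "k n z = x z" if "z \<in> B" for z
    proof -
      have "z \<in> C" using that C(3) by auto
      then show ?thesis using k(2)[of n z] c that by simp
    qed
    moreover have "x \<in> D2 (B, C, k)"
    proof -
      have "D2 (B, C, k) \<in> \<D>"
        using C k(1) finite_subset[OF C(3,1)] unfolding \<D>_def F_def by blast
      then show ?thesis using xD by blast
    qed
    ultimately obtain e where e: "e \<in> G" "\<forall>z\<in>B. e z = z" "\<forall>i<n. \<forall>z\<in>C. e (k i z) = g i (e z)"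
      "\<forall>z\<in>C. e (k n z) = x (e z)"
      unfolding D2_def by auto
    then have "e (c i z) = (g(n := x)) i (e z)" if "i < Suc n" "z \<in> C" for i z
      using that k(2)[of i z, symmetric] by (cases "i = n") auto
    then show "\<exists>e\<in>G. (\<forall>z\<in>B. e z = z) \<and> (\<forall>i<Suc n. \<forall>z\<in>C. e (c i z) = (g(n := x)) i (e z))"
      using e by blast
  qed
  ultimately show ?thesis by (rule that)
qed

end

section \<open>Subgroups of small index\<close>

definition conj_by :: "('a \<Rightarrow> 'a) \<Rightarrow> ('a \<Rightarrow> 'a) \<Rightarrow> 'a \<Rightarrow> 'a" where
  "conj_by h x = h \<circ> x \<circ> pinv h"

abbreviation path :: "nat set \<Rightarrow> nat \<Rightarrow> bool list" where
  "path a n \<equiv> map (\<lambda>i. i \<in> a) [0..<n]"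

lemma finite_lists_bool: "finite {s :: bool list. length s = n}"
  using finite_lists_length_eq[of "UNIV :: bool set" n] by simp

context eppa_perm_group begin

lemma stab_subset: "g \<in> stab A \<Longrightarrow> g \<in> G"
  by (simp add: stab_def)

lemma stab_comp: "g \<in> stab A \<Longrightarrow> h \<in> stab A \<Longrightarrow> g \<circ> h \<in> stab A"
  by (simp add: stab_def comp_G)

lemma stab_inv: "g \<in> stab A \<Longrightarrow> pinv g \<in> stab A"
proof -
  assume g: "g \<in> stab A"
  have "pinv g x = x" if "x \<in> A" for x
    using g that inv_G_left[of g x] by (simp add: stab_def)
  then show ?thesis using g by (simp add: stab_def inv_G)
qed

lemma conj_by_eqI:
  assumes "k \<in> G" "k \<circ> x = y \<circ> k"
  shows "conj_by k x = y"
proof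
  fix z
  have "k (x (pinv k z)) = y (k (pinv k z))" using assms(2) by (metis comp_apply)
  then show "conj_by k x z = y z" using assms(1) by (simp add: conj_by_def)
qed

lemma conj_by_comp:
  assumes "h \<in> G" "k \<in> G"
  shows "conj_by (h \<circ> k) x = conj_by h (conj_by k x)"
  using assms bij_G by (simp add: conj_by_def o_inv_distrib o_assoc)

text \<open>Left multiplication by \<open>y\<close> is a homeomorphism of \<open>stab A\<close>. It
  serves to find elements of the coset of some \<open>y\<close> outside \<open>H\<close>, hence
  non-members of \<open>H\<close>, in a given comeager set.\<close>

lemma dense_open_translate:
  assumes y: "y \<in> stab A" and D: "dense_open A D"
  shows "dense_open A {x. y \<circ> x \<in> D}"
  unfolding dense_open_def
proof (intro conjI ballI allI impI)
  fix x assume "x \<in> stab A \<inter> {x. y \<circ> x \<in> D}"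
  then have "y \<circ> x \<in> stab A \<inter> D" using y stab_comp by blast
  then obtain S where S: "finite S" "\<forall>w \<in> stab A. (\<forall>z\<in>S. w z = (y \<circ> x) z) \<longrightarrow> w \<in> D"
    using D unfolding dense_open_def by blast
  have "y \<circ> w \<in> D" if "w \<in> stab A" "\<forall>z\<in>S. w z = x z" for w
    using S(2) stab_comp[OF y that(1)] that(2) by simp
  then show "\<exists>S. finite S \<and> (\<forall>w\<in>stab A. (\<forall>z\<in>S. w z = x z) \<longrightarrow> w \<in> {x. y \<circ> x \<in> D})"
    using S(1) by blast
next
  fix x and S :: "'a set" assume "x \<in> stab A" "finite S"
  then obtain w where w: "w \<in> stab A \<inter> D" "\<forall>z\<in>S. w z = (y \<circ> x) z"
    using D stab_comp[OF y] unfolding dense_open_def by blast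
  have "y \<circ> (pinv y \<circ> w) = w" using stab_subset[OF y] by (simp add: fun_eq_iff)
  moreover have "pinv y \<circ> w \<in> stab A" using w y stab_comp stab_inv by blast
  moreover have "\<forall>z\<in>S. (pinv y \<circ> w) z = x z" using w(2) stab_subset[OF y] by simp
  ultimately show "\<exists>w\<in>stab A \<inter> {x. y \<circ> x \<in> D}. \<forall>z\<in>S. w z = x z"
    using w(1) by (intro bexI[of _ "pinv y \<circ> w"]) auto
qed

text \<open>The requirements are met one after the other. Each takes one change of
  \<open>x s\<close> away from the values fixed so far; then enough values are fixed for openness to
  secure the requirement for good. As \<open>s \<noteq> t\<close>, the change leaves
  \<open>x t\<close> alone.\<close>

lemma perturb_family:
  assumes "finite P" and "\<forall>(s, t, D) \<in> P. s \<noteq> t \<and> dense_open A D"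
    and "finite F" and "\<And>s. x s \<in> stab A"
  shows "\<exists>x' F'. finite F' \<and> F \<subseteq> F' \<and> (\<forall>s. x' s \<in> stab A \<and> (\<forall>z\<in>F. x' s z = x s z)) \<and>
    (\<forall>(s, t, D) \<in> P. \<forall>y\<in>stab A. \<forall>w\<in>stab A.
       (\<forall>z\<in>F'. y z = x' s z \<and> w z = x' t z) \<longrightarrow> y \<circ> pinv w \<in> D)"
  using assms
proof (induction P rule: finite_induct)
  case empty
  then show ?case by (intro exI[of _ x] exI[of _ F]) auto
next
  case (insert p P)
  obtain s t D where p: "p = (s, t, D)" by (cases p)
  have st: "s \<noteq> t" and D: "dense_open A D" using insert.prems(1) p by auto
  obtain x' F' where F': "finite F'" "F \<subseteq> F'"
    and x': "\<And>s. x' s \<in> stab A" "\<And>s z. z \<in> F \<Longrightarrow> x' s z = x s z"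
    and P: "\<And>s t D y w. (s, t, D) \<in> P \<Longrightarrow> y \<in> stab A \<Longrightarrow> w \<in> stab A \<Longrightarrow>
       (\<forall>z\<in>F'. y z = x' s z \<and> w z = x' t z) \<Longrightarrow> y \<circ> pinv w \<in> D"
  proof -
    have "\<forall>(s, t, D) \<in> P. s \<noteq> t \<and> dense_open A D" using insert.prems(1) by simp
    from insert.IH[OF this insert.prems(2,3)] obtain x' F' where
      *: "finite F'" "F \<subseteq> F'" "\<forall>s. x' s \<in> stab A \<and> (\<forall>z\<in>F. x' s z = x s z)"
      "\<forall>(s, t, D) \<in> P. \<forall>y\<in>stab A. \<forall>w\<in>stab A.
       (\<forall>z\<in>F'. y z = x' s z \<and> w z = x' t z) \<longrightarrow> y \<circ> pinv w \<in> D"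
      by (elim exE conjE)
    show ?thesis using * by (intro that[of F' x']) auto
  qed
  have x'G: "x' r \<in> G" for r using x'(1) by (rule stab_subset)
  have "x' s \<circ> pinv (x' t) \<in> stab A" using x'(1) stab_comp stab_inv by blast
  moreover have "finite (x' t ` F')" using F'(1) by simp
  \<comment> \<open>By density \<open>u\<close> can match the present quotient on the image of
    \<open>F'\<close>; then \<open>u \<circ> x' t\<close> still agrees with \<open>x' s\<close> on
    \<open>F'\<close>.\<close>
  ultimately obtain u where u: "u \<in> stab A \<inter> D"
    "\<forall>z\<in>x' t ` F'. u z = (x' s \<circ> pinv (x' t)) z"
    using D unfolding dense_open_def by blast
  obtain S where S: "finite S" "\<forall>y \<in> stab A. (\<forall>z\<in>S. y z = u z) \<longrightarrow> y \<in> D"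
    using D u(1) unfolding dense_open_def by blast
  define x'' where "x'' = x'(s := u \<circ> x' t)"
  \<comment> \<open>The values of \<open>y \<circ> pinv w\<close> on \<open>S\<close> are determined
    by \<open>y\<close> and \<open>w\<close> at the preimages of \<open>S\<close> under
    \<open>x' t\<close>. Fixing these forces agreement with \<open>u\<close> on
    \<open>S\<close>.\<close>
  define F'' where "F'' = F' \<union> pinv (x' t) ` S"
  have x''s: "x'' r \<in> stab A" for r using x'(1) u(1) stab_comp by (simp add: x''_def)
  have agree: "x'' r z = x' r z" if "z \<in> F'" for r z
    using that u(2) x'G[of t] by (simp add: x''_def)
  have "y \<circ> pinv w \<in> D" if y: "y \<in> stab A" and w: "w \<in> stab A"
    and yw: "\<forall>z\<in>F''. y z = x'' s z \<and> w z = x'' t z" for y w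
  proof -
    have "(y \<circ> pinv w) z = u z" if "z \<in> S" for z
    proof -
      define r where "r = pinv (x' t) z"
      have r: "r \<in> F''" "x' t r = z" using that x'G by (auto simp: F''_def r_def)
      have "w r = z" using yw r st by (simp add: x''_def)
      then have "pinv w z = r" using stab_subset[OF w] by auto
      then show ?thesis using yw r by (simp add: x''_def)
    qed
    moreover have "y \<circ> pinv w \<in> stab A" using y w stab_comp stab_inv by blast
    ultimately show ?thesis using S(2) by blast
  qed
  moreover have "y \<circ> pinv w \<in> E" if "(a, b, E) \<in> P" "y \<in> stab A" "w \<in> stab A"
    "\<forall>z\<in>F''. y z = x'' a z \<and> w z = x'' b z" for a b E y w
    using P[OF that(1-3)] that(4) agree by (simp add: F''_def)
  ultimately have "\<forall>(s, t, D) \<in> insert p P. \<forall>y\<in>stab A. \<forall>w\<in>stab A.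
       (\<forall>z\<in>F''. y z = x'' s z \<and> w z = x'' t z) \<longrightarrow> y \<circ> pinv w \<in> D"
    unfolding p by blast
  moreover have "finite F''" "F \<subseteq> F''" using F' S(1) by (auto simp: F''_def)
  moreover have "\<forall>r. x'' r \<in> stab A \<and> (\<forall>z\<in>F. x'' r z = x r z)"
    using x''s agree x'(2) F'(2) by (metis subsetD)
  ultimately show ?case by blast
qed

end

text \<open>\<open>H_small\<close>: no family indexed by the subsets of \<open>\<nat>\<close> lies in pairwise distinct cosets of \<open>H\<close>.\<close>

locale small_index_subgroup = eppa_perm_group G v for G :: "('a \<Rightarrow> 'a) set" and v +
  fixes H :: "('a \<Rightarrow> 'a) set"
  assumes H_subset: "h \<in> H \<Longrightarrow> h \<in> G"
    and H_comp: "g \<in> H \<Longrightarrow> h \<in> H \<Longrightarrow> g \<circ> h \<in> H"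
    and H_inv: "h \<in> H \<Longrightarrow> pinv h \<in> H"
    and H_small: "(\<And>a :: nat set. x a \<in> G) \<Longrightarrow> \<exists>a b. a \<noteq> b \<and> x a \<circ> pinv (x b) \<in> H"
begin

text \<open>Mycielski's argument: a perfect tree of elements \<open>q a\<close> all of whose quotients
  \<open>q a \<circ> pinv (q b)\<close> lie in the comeager set. Node \<open>s\<close> at level \<open>n\<close> carries the approximation \<open>x s\<close>,
  which is final on the finite set \<open>F\<close>.\<close>

lemma meets_comeager_nat:
  fixes D :: "nat \<Rightarrow> ('a \<Rightarrow> 'a) set"
  assumes A: "finite A" and D: "\<And>j. dense_open A (D j)"
  obtains h where "h \<in> H" "h \<in> stab A" "\<And>j. h \<in> D j"
proof -
  define P where "P n st \<longleftrightarrow> (case st of (x, F) \<Rightarrow> (\<forall>s. x s \<in> stab A) \<and> finite F \<and> v n \<in> F \<and>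
      (\<forall>s. length s = n \<longrightarrow> v n \<in> x s ` F))" for n and st :: "(bool list \<Rightarrow> 'a \<Rightarrow> 'a) \<times> 'a set"
  define Q where "Q n st st' \<longleftrightarrow> (case (st, st') of ((x, F), (x', F')) \<Rightarrow>
      F \<subseteq> F' \<and> (\<forall>s. \<forall>z\<in>F. x' s z = x (butlast s) z) \<and>
      (\<forall>s t. length s = Suc n \<and> length t = Suc n \<and> s \<noteq> t \<longrightarrow> (\<forall>j\<le>n. \<forall>y\<in>stab A. \<forall>w\<in>stab A.
         (\<forall>z\<in>F'. y z = x' s z \<and> w z = x' t z) \<longrightarrow> y \<circ> pinv w \<in> D j)))"
    for n and st st' :: "(bool list \<Rightarrow> 'a \<Rightarrow> 'a) \<times> 'a set"
  have "\<exists>f. \<forall>n. P n (f n) \<and> Q n (f n) (f (Suc n))"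
  proof (rule dependent_nat_choice)
    show "\<exists>st. P 0 st"
      by (rule exI[of _ "(\<lambda>_. id, {v 0})"]) (use id_G in \<open>auto simp: P_def stab_def\<close>)
  next
    fix st n assume "P n st"
    then obtain x F where st: "st = (x, F)" and x: "\<And>s. x s \<in> stab A" and F: "finite F"
      unfolding P_def by (cases st) auto
    define L where "L = {s :: bool list. length s = Suc n}"
    have L: "finite L" unfolding L_def by (rule finite_lists_bool)
    define T where "T = {(s, t, E). s \<in> L \<and> t \<in> L \<and> s \<noteq> t \<and> E \<in> D ` {..n}}"
    have "T \<subseteq> L \<times> L \<times> D ` {..n}" by (auto simp: T_def)
    then have "finite T" by (rule finite_subset) (use L in auto)
    moreover have "\<forall>(s, t, E) \<in> T. s \<noteq> t \<and> dense_open A E" using D by (auto simp: T_def)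
    ultimately obtain x' F' where F': "finite F'" "F \<subseteq> F'"
      and x': "\<forall>s. x' s \<in> stab A \<and> (\<forall>z\<in>F. x' s z = x (butlast s) z)"
      and T: "\<forall>(s, t, E) \<in> T. \<forall>y\<in>stab A. \<forall>w\<in>stab A.
       (\<forall>z\<in>F'. y z = x' s z \<and> w z = x' t z) \<longrightarrow> y \<circ> pinv w \<in> E"
      using perturb_family[of T A F "\<lambda>s. x (butlast s)"] F x by blast
    \<comment> \<open>The added points put \<open>v (Suc n)\<close> into the domain and the range of
      every approximation at this level, as \<open>limit_in_G\<close> demands.\<close>
    define F'' where "F'' = F' \<union> {v (Suc n)} \<union> (\<lambda>s. pinv (x' s) (v (Suc n))) ` L"
    have "P (Suc n) (x', F'')"
      unfolding P_def
    proof (clarify, intro conjI allI impI)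
      fix s :: "bool list" assume "length s = Suc n"
      then have "pinv (x' s) (v (Suc n)) \<in> F''" by (auto simp: F''_def L_def)
      moreover have "x' s (pinv (x' s) (v (Suc n))) = v (Suc n)"
        using x' stab_subset inv_G_right by blast
      ultimately show "v (Suc n) \<in> x' s ` F''" by (metis image_eqI)
    qed (use x' F' L in \<open>auto simp: F''_def\<close>)
    moreover have "Q n st (x', F'')"
      unfolding Q_def st
    proof (clarify, intro conjI allI impI ballI)
      fix s t :: "bool list" and j y w
      assume "length s = Suc n \<and> length t = Suc n \<and> s \<noteq> t" "j \<le> n"
        and yw: "y \<in> stab A" "w \<in> stab A" "\<forall>z\<in>F''. y z = x' s z \<and> w z = x' t z"
      then have "(s, t, D j) \<in> T" by (simp add: T_def L_def)
      then have "\<forall>y\<in>stab A. \<forall>w\<in>stab A.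
        (\<forall>z\<in>F'. y z = x' s z \<and> w z = x' t z) \<longrightarrow> y \<circ> pinv w \<in> D j"
        using T by fast
      then show "y \<circ> pinv w \<in> D j" using yw by (simp add: F''_def)
    qed (use x' F' in \<open>auto simp: F''_def\<close>)
    ultimately show "\<exists>st'. P (Suc n) st' \<and> Q n st st'" by blast
  qed
  then obtain f where f: "\<And>n. P n (f n)" "\<And>n. Q n (f n) (f (Suc n))" by blast
  define x where "x n = fst (f n)" for n
  define F where "F n = snd (f n)" for n
  have P: "P n (x n, F n)" for n using f(1)[of n] by (simp add: x_def F_def)
  have Q: "Q n (x n, F n) (x (Suc n), F (Suc n))" for n using f(2)[of n] by (simp add: x_def F_def)
  have "\<exists>q\<in>stab A. \<forall>n. \<forall>z\<in>F n. q z = x n (path a n) z" for a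
  proof -
    have xs: "x n s \<in> stab A" for n s using P[of n] by (simp add: P_def)
    obtain q where q: "q \<in> G" "\<And>n z. z \<in> F n \<Longrightarrow> q z = x n (path a n) z"
      "\<And>S. finite S \<Longrightarrow> \<exists>N. \<forall>n\<ge>N. \<forall>z\<in>S. q z = x n (path a n) z"
    proof (rule limit_in_G[of "\<lambda>n. x n (path a n)" F])
      show "x n (path a n) \<in> G" for n using xs by (rule stab_subset)
      show "x (Suc n) (path a (Suc n)) z = x n (path a n) z" if "z \<in> F n" for n z
      proof -
        have "\<forall>s. \<forall>z\<in>F n. x (Suc n) s z = x n (butlast s) z" using Q[of n] by (simp add: Q_def)
        then have "x (Suc n) (path a (Suc n)) z = x n (butlast (path a (Suc n))) z" using that by blast
        then show ?thesis by simp
      qed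
      show "v n \<in> F n" "F n \<subseteq> F (Suc n)" "v n \<in> x n (path a n) ` F n" for n
        using P[of n] Q[of n] by (auto simp: P_def Q_def)
    qed (rule that)
    have "q z = z" if "z \<in> A" for z
    proof -
      have "\<exists>N. \<forall>n\<ge>N. \<forall>y\<in>{z}. q y = x n (path a n) y" by (rule q(3)) simp
      then obtain N where "q z = x N (path a N) z" by auto
      then show ?thesis using xs that by (simp add: stab_def)
    qed
    then show ?thesis using q by (auto simp: stab_def)
  qed
  then obtain q where q: "\<And>a. q a \<in> stab A" "\<And>a n z. z \<in> F n \<Longrightarrow> q a z = x n (path a n) z"
    by metis
  obtain a b where ab: "a \<noteq> b" "q a \<circ> pinv (q b) \<in> H"
    using H_small[of q] stab_subset[OF q(1)] by blast
  show ?thesis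
  proof (rule that[OF ab(2)])
    show "q a \<circ> pinv (q b) \<in> stab A" using q(1) stab_comp stab_inv by blast
    fix j
    obtain i where i: "(i \<in> a) \<noteq> (i \<in> b)" using ab(1) by blast
    \<comment> \<open>From level \<open>Suc i\<close> on the two branches differ, and the passage to
      level \<open>Suc n\<close> treats all \<open>D j\<close> with
      \<open>j \<le> n\<close>.\<close>
    define n where "n = max i j"
    have "i < Suc n" by (simp add: n_def)
    then have "path a (Suc n) ! i \<noteq> path b (Suc n) ! i" using i by (simp del: upt_Suc)
    then have "path a (Suc n) \<noteq> path b (Suc n)" by metis
    moreover have "length (path c (Suc n)) = Suc n" for c by simp
    moreover have "j \<le> n" by (simp add: n_def)
    moreover have "\<forall>z\<in>F (Suc n). q a z = x (Suc n) (path a (Suc n)) z \<and>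
        q b z = x (Suc n) (path b (Suc n)) z" using q(2) by blast
    ultimately show "q a \<circ> pinv (q b) \<in> D j"
      using Q[of n] q(1) unfolding Q_def prod.case by blast
  qed
qed

lemma meets_comeager:
  assumes A: "finite A" and "countable \<D>" and D: "\<And>D. D \<in> \<D> \<Longrightarrow> dense_open A D"
  obtains h where "h \<in> H" "h \<in> stab A" "h \<in> \<Inter>\<D>"
proof (cases "\<D> = {}")
  case True
  \<comment> \<open>Membership of the identity comes from smallness: a constant family has a
    quotient in \<open>H\<close>.\<close>
  have "id \<circ> pinv id \<in> H" using H_small[of "\<lambda>_. id"] id_G by blast
  then show ?thesis using that[of id] True id_G by (simp add: stab_def)
next
  case False
  then have "range (from_nat_into \<D>) = \<D>" using \<open>countable \<D>\<close> by (simp add: range_from_nat_into)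
  moreover have "dense_open A (from_nat_into \<D> j)" for j
    using D False by (simp add: from_nat_into)
  ultimately show ?thesis using meets_comeager_nat[OF A, of "from_nat_into \<D>"] that
    by (metis (no_types, lifting) InterI rangeE)
qed

text \<open>A level of the tree has a single pair \<open>x\<close>, \<open>x'\<close> for all its
  nodes, so the pair must continue all tuples in \<open>K\<close> at once; finitely many comeager
  sets have a comeager intersection. The outside element is \<open>y \<circ> h\<close> with
  \<open>y\<close> outside \<open>H\<close> and \<open>h\<close> inside.\<close>

lemma generic_extend_inside_outside:
  assumes K: "finite K" "\<And>g. g \<in> K \<Longrightarrow> generic n g" and A: "finite A" and "\<not> stab A \<subseteq> H"
  obtains x x' where "x \<in> H" "x \<in> stab A" "x' \<notin> H" "x' \<in> stab A"
    "\<And>g. g \<in> K \<Longrightarrow> generic (Suc n) (g(n := x))" "\<And>g. g \<in> K \<Longrightarrow> generic (Suc n) (g(n := x'))"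
proof -
  have "\<exists>\<D>. countable \<D> \<and> (\<forall>D\<in>\<D>. dense_open A D) \<and>
    (\<forall>x\<in>stab A. x \<in> \<Inter>\<D> \<longrightarrow> generic (Suc n) (g(n := x)))" if "g \<in> K" for g
    using generic_extend_comeager[OF K(2)[OF that] A] by metis
  then obtain \<D> where \<D>: "\<And>g. g \<in> K \<Longrightarrow> countable (\<D> g)"
    "\<And>g D. g \<in> K \<Longrightarrow> D \<in> \<D> g \<Longrightarrow> dense_open A D"
    "\<And>g x. g \<in> K \<Longrightarrow> x \<in> stab A \<Longrightarrow> x \<in> \<Inter>(\<D> g) \<Longrightarrow> generic (Suc n) (g(n := x))"
    by metis
  define \<E> where "\<E> = (\<Union>g\<in>K. \<D> g)"
  have \<E>: "countable \<E>" "\<And>D. D \<in> \<E> \<Longrightarrow> dense_open A D"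
    "\<And>x g. x \<in> stab A \<Longrightarrow> x \<in> \<Inter>\<E> \<Longrightarrow> g \<in> K \<Longrightarrow> generic (Suc n) (g(n := x))"
    using \<D> K(1) by (auto simp: \<E>_def intro: countable_finite)
  obtain x where x: "x \<in> H" "x \<in> stab A" "x \<in> \<Inter>\<E>" using meets_comeager[OF A \<E>(1,2)] by blast
  obtain y where y: "y \<in> stab A" "y \<notin> H" using \<open>\<not> stab A \<subseteq> H\<close> by blast
  define \<E>' where "\<E>' = (\<lambda>D. {x. y \<circ> x \<in> D}) ` \<E>"
  have "countable \<E>'" "\<And>D. D \<in> \<E>' \<Longrightarrow> dense_open A D"
    using \<E>(1,2) dense_open_translate[OF y(1)] by (auto simp: \<E>'_def)
  then obtain h where h: "h \<in> H" "h \<in> stab A" "h \<in> \<Inter>\<E>'" using meets_comeager[OF A] by blast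
  have "y \<circ> h \<notin> H"
  proof
    assume "y \<circ> h \<in> H"
    then have "(y \<circ> h) \<circ> pinv h \<in> H" using h(1) H_comp H_inv by blast
    moreover have "(y \<circ> h) \<circ> pinv h = y" using H_subset[OF h(1)] by (simp add: fun_eq_iff)
    ultimately show False using y(2) by simp
  qed
  moreover have "y \<circ> h \<in> stab A" using y(1) h(2) by (rule stab_comp)
  moreover have "y \<circ> h \<in> \<Inter>\<E>" using h(3) by (auto simp: \<E>'_def)
  ultimately show ?thesis using that[of x "y \<circ> h"] x \<E>(3) by blast
qed

text \<open>\<open>X i False \<in> H\<close> and \<open>X i True \<notin> H\<close> are the two choices at level \<open>i\<close>, and \<open>h s\<close> is the
  approximation to \<open>q a\<close> at the node \<open>s\<close>. Later steps multiply \<open>h s\<close> by elements commuting with the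
  earlier choices along the branch, so that the conjugates fixed at level \<open>i\<close> persist.\<close>

lemma stab_subset_H: "\<exists>A. finite A \<and> stab A \<subseteq> H"
proof (rule ccontr)
  assume "\<nexists>A. finite A \<and> stab A \<subseteq> H"
  then have not_open: "\<not> stab A \<subseteq> H" if "finite A" for A using that by blast
  define P where "P n st \<longleftrightarrow> (case st of (X, h, F) \<Rightarrow>
      (\<forall>i<n. X i False \<in> H \<and> X i True \<notin> H) \<and> finite F \<and> v n \<in> F \<and>
      (\<forall>s. length s = n \<longrightarrow> h s \<in> G \<and> generic n (\<lambda>i. X i (s ! i)) \<and> v n \<in> h s ` F))"
    for n and st :: "(nat \<Rightarrow> bool \<Rightarrow> 'a \<Rightarrow> 'a) \<times> (bool list \<Rightarrow> 'a \<Rightarrow> 'a) \<times> 'a set"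
  define Q where "Q n st st' \<longleftrightarrow> (case (st, st') of ((X, h, F), (X', h', F')) \<Rightarrow>
      (\<forall>i<n. X' i = X i) \<and> F \<subseteq> F' \<and>
      (\<forall>s b. length s = n \<longrightarrow> (\<forall>z\<in>F. h' (s @ [b]) z = h s z) \<and>
         (\<forall>i<n. conj_by (h' (s @ [b])) (X i (s ! i)) = conj_by (h s) (X i (s ! i)))) \<and>
      (\<forall>s. length s = n \<longrightarrow>
         conj_by (h' (s @ [True])) (X' n True) = conj_by (h' (s @ [False])) (X' n False)))"
    for n and st st' :: "(nat \<Rightarrow> bool \<Rightarrow> 'a \<Rightarrow> 'a) \<times> (bool list \<Rightarrow> 'a \<Rightarrow> 'a) \<times> 'a set"
  have "\<exists>f. \<forall>n. P n (f n) \<and> Q n (f n) (f (Suc n))"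
  proof (rule dependent_nat_choice)
    show "\<exists>st. P 0 st"
      by (rule exI[of _ "(\<lambda>_ _. id, \<lambda>_. id, {v 0})"]) (use id_G generic_0 in \<open>auto simp: P_def\<close>)
  next
    fix st n assume "P n st"
    then obtain X h F where st: "st = (X, h, F)" and XH: "\<And>i. i < n \<Longrightarrow> X i False \<in> H \<and> X i True \<notin> H"
      and F: "finite F" and h: "\<And>s. length s = n \<Longrightarrow> h s \<in> G"
      and gen: "\<And>s. length s = n \<Longrightarrow> generic n (\<lambda>i. X i (s ! i))"
      unfolding P_def by (cases st) auto
    define L where "L k = {s :: bool list. length s = k}" for k
    have L: "finite (L k)" for k unfolding L_def by (rule finite_lists_bool)
    have "\<exists>B. finite B \<and> F \<subseteq> B \<and> (\<forall>i<n. X i (s ! i) ` B = B)" if s: "length s = n" for s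
      using generic_invariant_set[OF gen[OF s] F] by metis
    then obtain B where B: "\<And>s. length s = n \<Longrightarrow> finite (B s)" "\<And>s. length s = n \<Longrightarrow> F \<subseteq> B s"
      "\<And>s i. length s = n \<Longrightarrow> i < n \<Longrightarrow> X i (s ! i) ` B s = B s"
      by metis
    \<comment> \<open>Fixing the invariant sets of all nodes makes \<open>x\<close> and
      \<open>x'\<close> act trivially on each \<open>B s\<close>. The two continued tuples thus
      agree there, as conjugacy over \<open>B s\<close> requires.\<close>
    define A where "A = (\<Union>s\<in>L n. B s)"
    have A: "finite A" using L B(1) by (auto simp: A_def L_def)
    have "finite ((\<lambda>s i. X i (s ! i)) ` L n)" using L by blast
    then obtain x x' where x: "x \<in> H" "x \<in> stab A" "x' \<notin> H" "x' \<in> stab A"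
      and genx: "\<And>s. s \<in> L n \<Longrightarrow> generic (Suc n) ((\<lambda>i. X i (s ! i))(n := x))"
        "\<And>s. s \<in> L n \<Longrightarrow> generic (Suc n) ((\<lambda>i. X i (s ! i))(n := x'))"
    proof (rule generic_extend_inside_outside[OF _ _ A not_open[OF A]])
      fix g assume "g \<in> (\<lambda>s i. X i (s ! i)) ` L n"
      then show "generic n g" using gen by (auto simp: L_def)
    qed blast
    have "\<exists>k\<in>G. (\<forall>z\<in>B s. k z = z) \<and> (\<forall>i<n. k \<circ> X i (s ! i) = X i (s ! i) \<circ> k) \<and> k \<circ> x' = x \<circ> k"
      if s: "length s = n" for s
    proof -
      let ?g = "\<lambda>y. (\<lambda>i. X i (s ! i))(n := y)"
      have sL: "s \<in> L n" using s by (simp add: L_def)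
      have fix_B: "y z = z" if "y \<in> stab A" "z \<in> B s" for y z
        using that sL by (auto simp: stab_def A_def)
      have invB: "?g x' i ` B s = B s" if "i < Suc n" for i
      proof (cases "i = n")
        case True
        then show ?thesis using fix_B[OF x(4)] by simp
      next
        case False
        then show ?thesis using that B(3)[OF s, of i] by simp
      qed
      have eqB: "?g x' i z = ?g x i z" if "i < Suc n" "z \<in> B s" for i z
        using fix_B[OF x(2) that(2)] fix_B[OF x(4) that(2)] by simp
      obtain k where k: "k \<in> G" "\<And>z. z \<in> B s \<Longrightarrow> k z = z"
        "\<And>i. i < Suc n \<Longrightarrow> k \<circ> ?g x' i = ?g x i \<circ> k"
        by (rule generic_conjugate[where n = "Suc n" and g = "?g x'" and h = "?g x" and B = "B s"])
          (use genx sL B(1)[OF s] invB eqB in blast)+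
      have "k \<circ> X i (s ! i) = X i (s ! i) \<circ> k" if "i < n" for i using k(3)[of i] that by simp
      moreover have "k \<circ> x' = x \<circ> k" using k(3)[of n] by simp
      ultimately show ?thesis using k(1,2) by blast
    qed
    then obtain k where k: "\<And>s. length s = n \<Longrightarrow> k s \<in> G"
      "\<And>s z. length s = n \<Longrightarrow> z \<in> B s \<Longrightarrow> k s z = z"
      "\<And>s i. length s = n \<Longrightarrow> i < n \<Longrightarrow> k s \<circ> X i (s ! i) = X i (s ! i) \<circ> k s"
      "\<And>s. length s = n \<Longrightarrow> k s \<circ> x' = x \<circ> k s"
      by metis
    define X' where "X' = X(n := (\<lambda>b. if b then x' else x))"
    \<comment> \<open>Only the child \<open>True\<close> is corrected. Conjugation by
      \<open>k\<close> takes \<open>x'\<close> to \<open>x\<close>, so the two children send their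
      different choices to the same element. As \<open>k\<close> is the identity on
      \<open>B s\<close>, which contains \<open>F\<close>, the values on \<open>F\<close>
      persist.\<close>
    define h' where "h' t = (if last t then h (butlast t) \<circ> k (butlast t) else h (butlast t))" for t
    have h': "h' t \<in> G" if "length t = Suc n" for t
      using that h k(1) comp_G by (simp add: h'_def)
    define F' where "F' = F \<union> {v (Suc n)} \<union> (\<lambda>t. pinv (h' t) (v (Suc n))) ` L (Suc n)"
    have "P (Suc n) (X', h', F')"
      unfolding P_def
    proof (clarify, intro conjI allI impI)
      show "X' i False \<in> H" "X' i True \<notin> H" if "i < Suc n" for i
        using that XH[of i] x by (auto simp: X'_def less_Suc_eq)
      fix t :: "bool list" assume t: "length t = Suc n"
      show "h' t \<in> G" using h' t by simp
      have bt: "butlast t \<in> L n" using t by (simp add: L_def)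
      have "X' i (t ! i) = ((\<lambda>i. X i (butlast t ! i))(n := if t ! n then x' else x)) i" if "i < Suc n" for i
        using that t by (simp add: X'_def nth_butlast)
      moreover have "generic (Suc n) ((\<lambda>i. X i (butlast t ! i))(n := if t ! n then x' else x))"
        using genx bt by simp
      ultimately show "generic (Suc n) (\<lambda>i. X' i (t ! i))"
        using generic_cong[of "Suc n" "\<lambda>i. X' i (t ! i)"] by blast
      have "pinv (h' t) (v (Suc n)) \<in> F'" using t by (auto simp: F'_def L_def)
      then have "h' t (pinv (h' t) (v (Suc n))) \<in> h' t ` F'" by (rule imageI)
      then show "v (Suc n) \<in> h' t ` F'" using h'[OF t] by simp
    qed (use F L in \<open>auto simp: F'_def\<close>)
    moreover have "Q n st (X', h', F')"
      unfolding Q_def st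
    proof (clarify, intro conjI allI impI ballI)
      show "X' i = X i" if "i < n" for i using that by (simp add: X'_def)
      show "F \<subseteq> F'" by (auto simp: F'_def)
      fix s :: "bool list" assume s: "length s = n"
      show "h' (s @ [b]) z = h s z" if "z \<in> F" for b z
      proof -
        have "z \<in> B s" using that B(2)[OF s] by blast
        then show ?thesis using k(2)[OF s] by (simp add: h'_def)
      qed
      show "conj_by (h' (s @ [b])) (X i (s ! i)) = conj_by (h s) (X i (s ! i))" if "i < n" for b i
        using conj_by_eqI[OF k(1)[OF s] k(3)[OF s that]] h[OF s] k(1)[OF s]
        by (simp add: h'_def conj_by_comp)
      show "conj_by (h' (s @ [True])) (X' n True) = conj_by (h' (s @ [False])) (X' n False)"
        using conj_by_eqI[OF k(1)[OF s] k(4)[OF s]] h[OF s] k(1)[OF s]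
        by (simp add: h'_def X'_def conj_by_comp)
    qed
    ultimately show "\<exists>st'. P (Suc n) st' \<and> Q n st st'" by blast
  qed
  then obtain f where f: "\<And>n. P n (f n)" "\<And>n. Q n (f n) (f (Suc n))" by blast
  define X where "X n = fst (f n)" for n
  define h where "h n = fst (snd (f n))" for n
  define F where "F n = snd (snd (f n))" for n
  have P: "P n (X n, h n, F n)" for n using f(1)[of n] by (simp add: X_def h_def F_def)
  have Q: "Q n (X n, h n, F n) (X (Suc n), h (Suc n), F (Suc n))" for n
    using f(2)[of n] by (simp add: X_def h_def F_def)
  \<comment> \<open>The choice with index \<open>i\<close> is made in passing to stage
    \<open>Suc i\<close> and never revised.\<close>
  define Y where "Y i = X (Suc i) i" for i
  have XY: "X n i = Y i" if "i < n" for i n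
  proof -
    have "Suc i \<le> n" using that by simp
    then show ?thesis
    proof (induction n rule: dec_induct)
      case (step n)
      then show ?case using Q[of n] by (simp add: Q_def)
    qed (simp add: Y_def)
  qed
  have YH: "Y i False \<in> H" "Y i True \<notin> H" for i using P[of "Suc i"] by (simp_all add: P_def Y_def)
  have hG: "h n (path a n) \<in> G" for n a using P[of n] by (simp add: P_def)
  have YG: "Y i b \<in> G" for i b
  proof -
    \<comment> \<open>The constant word is merely some node whose entry at \<open>i\<close> is
      \<open>b\<close>; genericity there gives membership in \<open>G\<close>.\<close>
    have "generic (Suc i) (\<lambda>j. X (Suc i) j (replicate (Suc i) b ! j))"
      using P[of "Suc i"] unfolding P_def prod.case by (metis length_replicate)
    then have "X (Suc i) i (replicate (Suc i) b ! i) \<in> G" using generic_in_G by blast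
    then show ?thesis by (simp add: Y_def del: replicate_Suc)
  qed
  have "\<exists>q\<in>G. \<forall>S. finite S \<longrightarrow> (\<exists>N. \<forall>n\<ge>N. \<forall>z\<in>S. q z = h n (path a n) z)" for a
  proof -
    obtain q where q: "q \<in> G" "\<And>n z. z \<in> F n \<Longrightarrow> q z = h n (path a n) z"
      "\<And>S. finite S \<Longrightarrow> \<exists>N. \<forall>n\<ge>N. \<forall>z\<in>S. q z = h n (path a n) z"
    proof (rule limit_in_G[of "\<lambda>n. h n (path a n)" F])
      show "h n (path a n) \<in> G" for n by (rule hG)
      show "h (Suc n) (path a (Suc n)) z = h n (path a n) z" if "z \<in> F n" for n z
        using Q[of n] that by (simp add: Q_def)
      show "v n \<in> F n" "F n \<subseteq> F (Suc n)" "v n \<in> h n (path a n) ` F n" for n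
        using P[of n] Q[of n] by (simp_all add: P_def Q_def)
    qed (rule that)
    then show ?thesis by blast
  qed
  then obtain q where q: "\<And>a. q a \<in> G"
    "\<And>a S. finite S \<Longrightarrow> \<exists>N. \<forall>n\<ge>N. \<forall>z\<in>S. q a z = h n (path a n) z"
    by metis
  \<comment> \<open>Along a branch this conjugate is constant from level \<open>Suc i\<close> on.
    Its value at \<open>w\<close> under \<open>q a\<close> depends on \<open>q a\<close> at two
    points only, where \<open>q a\<close> agrees with a late approximation.\<close>
  have conj_q: "conj_by (q a) (Y i (i \<in> a)) = conj_by (h (Suc i) (path a (Suc i))) (Y i (i \<in> a))" for a i
  proof
    fix w
    have stable: "conj_by (h n (path a n)) (Y i (i \<in> a)) = conj_by (h (Suc i) (path a (Suc i))) (Y i (i \<in> a))"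
      if "Suc i \<le> n" for n
      using that
    proof (induction n rule: dec_induct)
      case (step n)
      have "length (path a n) = n" "i < n" using step(1) by simp_all
      then have "conj_by (h (Suc n) (path a n @ [n \<in> a])) (X n i (path a n ! i)) =
          conj_by (h n (path a n)) (X n i (path a n ! i))"
        using Q[of n] unfolding Q_def prod.case by blast
      moreover have "X n i (path a n ! i) = Y i (i \<in> a)" using XY[of i n] step(1) by simp
      moreover have "path a (Suc n) = path a n @ [n \<in> a]" by simp
      ultimately show ?case using step.IH by metis
    qed simp
    let ?r = "pinv (q a) w"
    obtain N where N: "\<forall>n\<ge>N. \<forall>z\<in>{?r, Y i (i \<in> a) ?r}. q a z = h n (path a n) z"
      using q(2)[of "{?r, Y i (i \<in> a) ?r}" a] by auto
    define n where "n = max N (Suc i)"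
    have n: "q a ?r = h n (path a n) ?r" "q a (Y i (i \<in> a) ?r) = h n (path a n) (Y i (i \<in> a) ?r)"
      using N by (simp_all add: n_def)
    have "pinv (h n (path a n)) w = ?r" using n(1) q(1)[of a] inv_G_left[OF hG[of n a], of ?r] by simp
    then have "conj_by (q a) (Y i (i \<in> a)) w = conj_by (h n (path a n)) (Y i (i \<in> a)) w"
      using n(2) by (simp add: conj_by_def)
    also have "\<dots> = conj_by (h (Suc i) (path a (Suc i))) (Y i (i \<in> a)) w"
      using stable[of n] by (simp add: n_def)
    finally show "conj_by (q a) (Y i (i \<in> a)) w = conj_by (h (Suc i) (path a (Suc i))) (Y i (i \<in> a)) w" .
  qed
  \<comment> \<open>Otherwise an element of \<open>H\<close> would conjugate
    \<open>Y i False\<close>, which is in \<open>H\<close>, to \<open>Y i True\<close>, which is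
    not.\<close>
  have separate: "pinv (q a) \<circ> q b \<notin> H" if i: "i \<in> a" "i \<notin> b" "path a i = path b i" for a b i
  proof
    define u where "u = pinv (q a) \<circ> q b"
    assume "pinv (q a) \<circ> q b \<in> H"
    then have u: "u \<in> H" by (simp add: u_def)
    have "conj_by (q a) (Y i True) = conj_by (h (Suc i) (path b i @ [True])) (Y i True)"
      using conj_q[of a i] i by simp
    also have "\<dots> = conj_by (h (Suc i) (path b i @ [False])) (Y i False)"
      using Q[of i] by (simp add: Q_def Y_def)
    also have "\<dots> = conj_by (q b) (Y i False)"
      using conj_q[of b i] i by simp
    finally have eq: "conj_by (q a) (Y i True) = conj_by (q b) (Y i False)" .
    have "Y i True = conj_by u (Y i False)"
    proof
      fix z
      have "pinv u = pinv (q b) \<circ> q a"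
        using q(1)[of a] q(1)[of b] bij_G inv_G by (simp add: u_def o_inv_distrib inv_inv_eq)
      then have "conj_by u (Y i False) z = pinv (q a) (conj_by (q b) (Y i False) (q a z))"
        by (simp add: conj_by_def u_def)
      also have "\<dots> = Y i True z" unfolding eq[symmetric] using q(1)[of a] by (simp add: conj_by_def)
      finally show "Y i True z = conj_by u (Y i False) z" by simp
    qed
    moreover have "conj_by u (Y i False) \<in> H"
      unfolding conj_by_def using u YH(1) H_comp H_inv by blast
    ultimately show False using YH(2)[of i] by metis
  qed
  \<comment> \<open>\<open>H_small\<close> speaks of \<open>x a \<circ> pinv (x b)\<close> but
    \<open>separate\<close> of \<open>pinv (q a) \<circ> q b\<close>; inverting the family matches
    them. The inverse quotient is recorded too, since the first difference may lie in either
    set.\<close>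
  obtain a b where ab: "a \<noteq> b" "pinv (q a) \<circ> pinv (pinv (q b)) \<in> H"
    using H_small[of "\<lambda>a. pinv (q a)"] q(1) inv_G by blast
  have ab_H: "pinv (q a) \<circ> q b \<in> H" using ab(2) q(1)[of b] bij_G by (simp add: inv_inv_eq)
  then have "pinv (pinv (q a) \<circ> q b) \<in> H" by (rule H_inv)
  then have ba_H: "pinv (q b) \<circ> q a \<in> H"
    using q(1)[of a] q(1)[of b] bij_G inv_G by (simp add: o_inv_distrib inv_inv_eq)
  define i where "i = (LEAST i. (i \<in> a) \<noteq> (i \<in> b))"
  have "\<exists>i. (i \<in> a) \<noteq> (i \<in> b)" using ab(1) by blast
  then have i: "(i \<in> a) \<noteq> (i \<in> b)" unfolding i_def by (rule LeastI_ex)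
  have "(j \<in> a) = (j \<in> b)" if "j < i" for j using that not_less_Least unfolding i_def by blast
  then have "path a i = path b i" by simp
  then show False using i separate[of i a b] separate[of i b a] ab_H ba_H by auto
qed

end

section \<open>Extending partial automorphisms of finite clique-free graphs\<close>

definition clique :: "'a rel \<Rightarrow> 'a set \<Rightarrow> bool" where
  "clique E U \<longleftrightarrow> (\<forall>x\<in>U. \<forall>y\<in>U. x \<noteq> y \<longrightarrow> (x, y) \<in> E)"

definition clique_free :: "nat \<Rightarrow> 'a set \<Rightarrow> 'a rel \<Rightarrow> bool" where
  "clique_free m V E \<longleftrightarrow> (\<forall>U \<subseteq> V. finite U \<longrightarrow> card U = m \<longrightarrow> \<not> clique E U)"

text \<open>An embedding must also reflect non-edges; at equal arguments this needs the absence of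
  loops.\<close>

lemma complete_free_iff_clique_free:
  assumes "irrefl E"
  shows "complete_free m V E \<longleftrightarrow> clique_free m V E"
proof
  assume free: "complete_free m V E"
  show "clique_free m V E"
    unfolding clique_free_def
  proof (intro allI impI notI)
    fix U assume U: "U \<subseteq> V" "finite U" "card U = m" "clique E U"
    then obtain f where f: "bij_betw f {..<m} U"
      using ex_bij_betw_nat_finite[of U] by (auto simp: atLeast0LessThan)
    have "graph_embedding f {..<m} (complete_edges {..<m}) V E"
      unfolding graph_embedding_def
    proof (intro conjI ballI)
      show "inj_on f {..<m}" "f ` {..<m} \<subseteq> V" using f U(1) by (auto simp: bij_betw_def)
      fix x y assume xy: "x \<in> {..<m}" "y \<in> {..<m}"
      then have "f x \<in> U" "f y \<in> U" "f x = f y \<longleftrightarrow> x = y"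
        using f by (auto simp: bij_betw_def inj_on_def)
      then show "(f x, f y) \<in> E \<longleftrightarrow> (x, y) \<in> complete_edges {..<m}"
        using xy U(4) assms by (auto simp: clique_def complete_edges_def irrefl_def)
    qed
    then show False using free by (auto simp: complete_free_def)
  qed
next
  assume free: "clique_free m V E"
  show "complete_free m V E"
    unfolding complete_free_def
  proof
    assume "\<exists>f :: nat \<Rightarrow> 'a. graph_embedding f {..<m} (complete_edges {..<m}) V E"
    then obtain f :: "nat \<Rightarrow> 'a" where f: "inj_on f {..<m}" "f ` {..<m} \<subseteq> V"
      "\<forall>x\<in>{..<m}. \<forall>y\<in>{..<m}. (f x, f y) \<in> E \<longleftrightarrow> (x, y) \<in> complete_edges {..<m}"
      by (auto simp: graph_embedding_def)
    then have "clique E (f ` {..<m})" by (auto simp: clique_def complete_edges_def)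
    moreover have "card (f ` {..<m}) = m" using f(1) by (simp add: card_image)
    ultimately show False using free f(2) by (auto simp: clique_free_def)
  qed
qed

lemma clique_free_embedding:
  assumes "clique_free m W F" and "inj_on f V" "f ` V \<subseteq> W"
    and "\<And>x y. x \<in> V \<Longrightarrow> y \<in> V \<Longrightarrow> (x, y) \<in> E \<Longrightarrow> (f x, f y) \<in> F"
  shows "clique_free m V E"
  unfolding clique_free_def
proof (intro allI impI notI)
  fix U assume U: "U \<subseteq> V" "finite U" "card U = m" "clique E U"
  have inj: "inj_on f U" using assms(2) U(1) by (rule inj_on_subset)
  then have "card (f ` U) = m" using U(3) by (simp add: card_image)
  moreover have "clique F (f ` U)"
    unfolding clique_def
  proof (intro ballI impI)
    fix a b assume "a \<in> f ` U" "b \<in> f ` U" "a \<noteq> b"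
    then obtain x y where "x \<in> U" "y \<in> U" "a = f x" "b = f y" "x \<noteq> y" by blast
    moreover from this have "(x, y) \<in> E" "x \<in> V" "y \<in> V" using U(1,4) by (auto simp: clique_def)
    ultimately show "(a, b) \<in> F" using assms(4) by simp
  qed
  moreover have "f ` U \<subseteq> W" using U(1) assms(3) by blast
  ultimately show False using assms(1) U(2) by (auto simp: clique_free_def)
qed

lemma extend_to_permutation:
  assumes A: "finite A" and D: "D \<subseteq> A" and p: "inj_on p D" "p ` D \<subseteq> A"
  obtains \<sigma> where "bij_betw \<sigma> A A" "\<And>x. x \<in> D \<Longrightarrow> \<sigma> x = p x"
proof -
  have "card (A - D) = card (A - p ` D)"
    using A D p by (simp add: card_Diff_subset finite_subset card_image)
  then obtain r where r: "bij_betw r (A - D) (A - p ` D)"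
    using A finite_same_card_bij[of "A - D" "A - p ` D"] by blast
  define \<sigma> where "\<sigma> x = (if x \<in> D then p x else r x)" for x
  have "bij_betw \<sigma> D (p ` D)" using p(1) by (simp add: \<sigma>_def bij_betw_def inj_on_def)
  moreover have "bij_betw \<sigma> (A - D) (A - p ` D)"
    using r by (rule bij_betw_cong[THEN iffD1, rotated]) (simp add: \<sigma>_def)
  ultimately have "bij_betw \<sigma> (D \<union> (A - D)) (p ` D \<union> (A - p ` D))"
    by (rule bij_betw_combine) blast
  moreover have "D \<union> (A - D) = A" "p ` D \<union> (A - p ` D) = A" using D p(2) by auto
  ultimately show ?thesis using that[of \<sigma>] by (simp add: \<sigma>_def)
qed

definition partial_isomorphism :: "'a rel \<Rightarrow> 'a set \<Rightarrow> 'a set \<Rightarrow> ('a \<Rightarrow> 'a) \<Rightarrow> bool" where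
  "partial_isomorphism E A D p \<longleftrightarrow> D \<subseteq> A \<and> inj_on p D \<and> p ` D \<subseteq> A \<and>
     (\<forall>x\<in>D. \<forall>y\<in>D. (p x, p y) \<in> E \<longleftrightarrow> (x, y) \<in> E)"

lemma graph_isomorphism_finiteI:
  assumes "finite W" "f ` W \<subseteq> W" "inj_on f W"
    and "\<And>x y. x \<in> W \<Longrightarrow> y \<in> W \<Longrightarrow> (f x, f y) \<in> F \<longleftrightarrow> (x, y) \<in> F"
  shows "graph_isomorphism f W F W F"
  using assms endo_inj_surj[of W f] by (auto simp: graph_isomorphism_def bij_betw_def)

text \<open>Two vertices \<open>(x, S)\<close> and \<open>(y, T)\<close> in distinct columns are adjacent iff exactly one of
  \<open>y \<in> S\<close> and \<open>x \<in> T\<close> holds, so flipping both memberships is an automorphism. A partial isomorphism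
  is extended by permuting the columns and flipping where needed.\<close>

lemma graph_eppa:
  fixes A :: "'a set"
  assumes A: "finite A" and E: "sym E" "irrefl E"
  obtains W :: "('a \<times> 'a set) set" and F i where "finite W" "graph W F" "inj_on i A" "i ` A \<subseteq> W"
    "\<And>x y. x \<in> A \<Longrightarrow> y \<in> A \<Longrightarrow> (i x, i y) \<in> F \<longleftrightarrow> (x, y) \<in> E"
    "\<And>D p. partial_isomorphism E A D p \<Longrightarrow>
       \<exists>\<theta>. graph_isomorphism \<theta> W F W F \<and> (\<forall>x\<in>D. \<theta> (i x) = i (p x))"
proof -
  obtain r :: "'a \<Rightarrow> nat" where r: "inj_on r A"
    using finite_imp_inj_to_nat_seg[OF A] by blast
  define W where "W = A \<times> Pow A"
  define F where "F = {((x, S), (y, T)). (x, S) \<in> W \<and> (y, T) \<in> W \<and> x \<noteq> y \<and> (y \<in> S) \<noteq> (x \<in> T)}"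
  \<comment> \<open>The numbering \<open>r\<close> assigns each edge to its earlier endpoint, so
    exactly one of the two memberships holds for an edge and neither for a non-edge.\<close>
  define N where "N x = {y \<in> A. (x, y) \<in> E \<and> r x < r y}" for x
  define i where "i x = (x, N x)" for x
  have W: "finite W" using A by (simp add: W_def)
  have F_iff: "((x, S), (y, T)) \<in> F \<longleftrightarrow>
      (x, S) \<in> W \<and> (y, T) \<in> W \<and> x \<noteq> y \<and> (y \<in> S) \<noteq> (x \<in> T)" for x S y T
    by (simp add: F_def)
  have "graph W F" unfolding graph_def
    by (auto simp: F_def sym_def irrefl_def)
  moreover have "inj_on i A" by (simp add: i_def inj_on_def)
  moreover have iW: "i ` A \<subseteq> W" by (auto simp: i_def W_def N_def)
  have N: "(y \<in> N x) \<noteq> (x \<in> N y) \<longleftrightarrow> (x, y) \<in> E" if "x \<in> A" "y \<in> A" "x \<noteq> y" for x y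
  proof -
    have "r x \<noteq> r y" using r that by (auto simp: inj_on_def)
    moreover have "(x, y) \<in> E \<longleftrightarrow> (y, x) \<in> E" using E(1) by (auto simp: sym_def)
    ultimately show ?thesis using that by (auto simp: N_def)
  qed
  moreover have "(i x, i y) \<in> F \<longleftrightarrow> (x, y) \<in> E" if "x \<in> A" "y \<in> A" for x y
    using iW that N[of x y] E(2) unfolding i_def F_iff by (auto simp: irrefl_def)
  moreover have "\<exists>\<theta>. graph_isomorphism \<theta> W F W F \<and> (\<forall>x\<in>D. \<theta> (i x) = i (p x))"
    if p: "partial_isomorphism E A D p" for D p
  proof -
    have D: "D \<subseteq> A" "inj_on p D" "p ` D \<subseteq> A"
      and pE: "\<And>x y. x \<in> D \<Longrightarrow> y \<in> D \<Longrightarrow> (p x, p y) \<in> E \<longleftrightarrow> (x, y) \<in> E"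
      using p by (auto simp: partial_isomorphism_def)
    obtain \<sigma> where \<sigma>: "bij_betw \<sigma> A A" "\<And>x. x \<in> D \<Longrightarrow> \<sigma> x = p x"
      using extend_to_permutation[OF A D] by blast
    have \<sigma>A: "\<sigma> x \<in> A" if "x \<in> A" for x using \<sigma>(1) that by (auto simp: bij_betw_def)
    have \<sigma>_inj: "\<sigma> x = \<sigma> y \<longleftrightarrow> x = y" if "x \<in> A" "y \<in> A" for x y
      using \<sigma>(1) that by (auto simp: bij_betw_def inj_on_def)
    \<comment> \<open>This records whether the coordinate \<open>y\<close> of column
      \<open>x\<close> must be flipped for \<open>N x\<close> to go to
      \<open>N (p x)\<close>.\<close>
    define d where "d x y \<longleftrightarrow> (y \<in> N x) \<noteq> (\<sigma> y \<in> N (p x))" for x y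
    \<comment> \<open>Flips preserve adjacency only if they are symmetric. Inside \<open>D\<close>
      the two demands agree because \<open>p\<close> preserves edges and non-edges; a pair with one
      end in \<open>D\<close> follows that end, and a pair outside \<open>D\<close> is not
      flipped.\<close>
    define fl where "fl x y \<longleftrightarrow> (if x \<in> D then d x y else y \<in> D \<and> d y x)" for x y
    have d_sym: "d x y = d y x" if "x \<in> D" "y \<in> D" "x \<noteq> y" for x y
    proof -
      have xy: "x \<in> A" "y \<in> A" using that D(1) by auto
      have "p x \<in> A" "p y \<in> A" "p x \<noteq> p y" using that D(2,3) by (auto simp: inj_on_def)
      then have "((p y \<in> N (p x)) \<noteq> (p x \<in> N (p y))) = ((y \<in> N x) \<noteq> (x \<in> N y))"
        using N[OF xy that(3)] N[of "p x" "p y"] pE that by simp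
      then show ?thesis using \<sigma>(2) that by (auto simp: d_def)
    qed
    have fl_sym: "fl x y = fl y x" if "x \<noteq> y" for x y
      using d_sym[of x y] that by (auto simp: fl_def)
    define fs where "fs x S = \<sigma> ` {y \<in> A. (y \<in> S) \<noteq> fl x y}" for x S
    have fs: "\<sigma> y \<in> fs x S \<longleftrightarrow> (y \<in> S) \<noteq> fl x y" if "y \<in> A" for x y S
      using that \<sigma>_inj by (auto simp: fs_def)
    define \<theta> where "\<theta> = (\<lambda>(x, S). (\<sigma> x, fs x S))"
    have \<theta>W: "\<theta> (x, S) \<in> W" if "(x, S) \<in> W" for x S
      using that \<sigma>A by (auto simp: \<theta>_def W_def fs_def)
    have "graph_isomorphism \<theta> W F W F"
    proof (rule graph_isomorphism_finiteI[OF W])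
      show "\<theta> ` W \<subseteq> W" using \<theta>W by auto
      show "inj_on \<theta> W"
      proof (rule inj_onI)
        fix a b assume ab: "a \<in> W" "b \<in> W" "\<theta> a = \<theta> b"
        obtain x S y T where xy: "a = (x, S)" "b = (y, T)" by (cases a, cases b)
        then have A: "x \<in> A" "y \<in> A" "S \<subseteq> A" "T \<subseteq> A" using ab by (auto simp: W_def)
        then have "x = y" "fs x S = fs y T" using ab(3) \<sigma>_inj by (auto simp: \<theta>_def xy)
        then have "z \<in> S \<longleftrightarrow> z \<in> T" if "z \<in> A" for z
          using fs[OF that, of x S] fs[OF that, of x T] by auto
        then show "a = b" using \<open>x = y\<close> A unfolding xy by blast
      qed
      fix a b assume ab: "a \<in> W" "b \<in> W"
      obtain x S y T where xy: "a = (x, S)" "b = (y, T)" by (cases a, cases b)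
      then have A: "x \<in> A" "y \<in> A" using ab by (auto simp: W_def)
      have "(\<sigma> y \<in> fs x S) \<noteq> (\<sigma> x \<in> fs y T) \<longleftrightarrow> (y \<in> S) \<noteq> (x \<in> T)" if "x \<noteq> y"
        using fs[OF A(2), of x S] fs[OF A(1), of y T] fl_sym[OF that] by auto
      then show "(\<theta> a, \<theta> b) \<in> F \<longleftrightarrow> (a, b) \<in> F"
        using ab \<theta>W[of x S] \<theta>W[of y T] \<sigma>_inj[OF A] unfolding xy
        by (auto simp: \<theta>_def F_iff)
    qed
    moreover have "\<theta> (i x) = i (p x)" if x: "x \<in> D" for x
    proof -
      have "\<sigma> y \<in> fs x (N x) \<longleftrightarrow> \<sigma> y \<in> N (p x)" if "y \<in> A" for y
        using fs[OF that, of x "N x"] x by (auto simp: fl_def d_def)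
      moreover have "fs x (N x) \<subseteq> \<sigma> ` A" "N (p x) \<subseteq> \<sigma> ` A"
        using \<sigma>(1) by (auto simp: fs_def N_def bij_betw_def)
      ultimately have "fs x (N x) = N (p x)" by blast
      then show ?thesis using \<sigma>(2)[OF x] by (simp add: \<theta>_def i_def)
    qed
    ultimately show ?thesis by blast
  qed
  ultimately show ?thesis using that[OF W, of F i] iW by blast
qed

text \<open>A vertex of the cover is a vertex \<open>v\<close> of the given graph with a colour for each \<open>m\<close>-clique
  through \<open>v\<close>; adjacent vertices must have different colours at every common clique. An \<open>m\<close>-clique
  of the cover would need \<open>m\<close> colours at its projection, and only \<open>m - 1\<close> are available.\<close>

lemma clique_free_cover:
  fixes A :: "'b set"
  assumes B: "finite B" "graph B F" and AB: "A \<subseteq> B" and free: "clique_free m A F" and m: "m \<ge> 1"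
  obtains W :: "('b \<times> ('b set \<Rightarrow> nat)) set" and E i where
    "finite W" "graph W E" "clique_free m W E" "inj_on i A" "i ` A \<subseteq> W"
    "\<And>x y. x \<in> A \<Longrightarrow> y \<in> A \<Longrightarrow> (i x, i y) \<in> E \<longleftrightarrow> (x, y) \<in> F"
    "\<And>\<theta> D. graph_isomorphism \<theta> B F B F \<Longrightarrow> D \<subseteq> A \<Longrightarrow> \<theta> ` D \<subseteq> A \<Longrightarrow>
       \<exists>\<Theta>. graph_isomorphism \<Theta> W E W E \<and> (\<forall>x\<in>D. \<Theta> (i x) = i (\<theta> x))"
proof -
  define Q where "Q = {U. U \<subseteq> B \<and> card U = m \<and> clique F U}"
  define Qv where "Qv v = {U \<in> Q. v \<in> U}" for v
  define W where "W = (SIGMA v:B. Qv v \<rightarrow>\<^sub>E {..<m - 1})"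
  define E where "E = {((v, \<chi>), (w, \<xi>)). (v, \<chi>) \<in> W \<and> (w, \<xi>) \<in> W \<and> (v, w) \<in> F \<and>
      (\<forall>U\<in>Q. v \<in> U \<and> w \<in> U \<longrightarrow> \<chi> U \<noteq> \<xi> U)}"
  have symF: "sym F" and irF: "irrefl F" using B(2) by (auto simp: graph_def)
  have E_iff: "((v, \<chi>), (w, \<xi>)) \<in> E \<longleftrightarrow> (v, \<chi>) \<in> W \<and> (w, \<xi>) \<in> W \<and> (v, w) \<in> F \<and>
      (\<forall>U\<in>Q. v \<in> U \<and> w \<in> U \<longrightarrow> \<chi> U \<noteq> \<xi> U)" for v \<chi> w \<xi>
    by (simp add: E_def)
  have "finite Q" unfolding Q_def using B(1) by (auto intro: finite_subset[of _ "Pow B"])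
  then have finQv: "finite (Qv v)" for v by (simp add: Qv_def)
  have W: "finite W" unfolding W_def using B(1) finQv by (auto intro!: finite_SigmaI finite_PiE)
  have "graph W E"
    unfolding graph_def
  proof (intro conjI)
    show "E \<subseteq> W \<times> W" by (auto simp: E_def)
    show "sym E" using symF by (auto simp: E_def sym_def)
    show "irrefl E" using irF by (auto simp: E_def irrefl_def)
  qed
  moreover have "clique_free m W E"
    unfolding clique_free_def
  proof (intro allI impI notI)
    fix K assume K: "K \<subseteq> W" "finite K" "card K = m" "clique E K"
    have adj: "(fst a, fst b) \<in> F" "\<forall>U\<in>Q. fst a \<in> U \<and> fst b \<in> U \<longrightarrow> snd a U \<noteq> snd b U"
      if "a \<in> K" "b \<in> K" "a \<noteq> b" for a b
    proof -
      have "((fst a, snd a), (fst b, snd b)) \<in> E" using K(4) that by (simp add: clique_def)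
      then show "(fst a, fst b) \<in> F" "\<forall>U\<in>Q. fst a \<in> U \<and> fst b \<in> U \<longrightarrow> snd a U \<noteq> snd b U"
        unfolding E_iff by blast+
    qed
    have "inj_on fst K"
    proof (rule inj_onI, rule ccontr)
      fix a b assume "a \<in> K" "b \<in> K" "fst a = fst b" "a \<noteq> b"
      then show False using adj(1)[of a b] irF by (simp add: irrefl_def)
    qed
    then have "card (fst ` K) = m" using K(3) by (simp add: card_image)
    moreover have "fst ` K \<subseteq> B" using K(1) by (auto simp: W_def)
    moreover have "clique F (fst ` K)"
      unfolding clique_def
    proof (intro ballI impI)
      fix x y assume "x \<in> fst ` K" "y \<in> fst ` K" "x \<noteq> y"
      then obtain a b where "a \<in> K" "b \<in> K" "x = fst a" "y = fst b" "a \<noteq> b" by blast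
      then show "(x, y) \<in> F" using adj(1) by blast
    qed
    ultimately have U: "fst ` K \<in> Q" by (simp add: Q_def)
    have "inj_on (\<lambda>a. snd a (fst ` K)) K"
    proof (rule inj_onI, rule ccontr)
      fix a b assume "a \<in> K" "b \<in> K" "snd a (fst ` K) = snd b (fst ` K)" "a \<noteq> b"
      then show False using adj(2)[of a b] U by blast
    qed
    moreover have "(\<lambda>a. snd a (fst ` K)) ` K \<subseteq> {..<m - 1}"
    proof
      fix c assume "c \<in> (\<lambda>a. snd a (fst ` K)) ` K"
      then obtain a where a: "a \<in> K" "c = snd a (fst ` K)" by blast
      then have "(fst a, snd a) \<in> W" using K(1) by auto
      then have "snd a \<in> Qv (fst a) \<rightarrow>\<^sub>E {..<m - 1}" unfolding W_def by blast
      moreover have "fst ` K \<in> Qv (fst a)" using U a(1) by (simp add: Qv_def)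
      ultimately show "c \<in> {..<m - 1}" unfolding a(2) by (rule PiE_mem)
    qed
    ultimately have "card K \<le> m - 1" using card_inj_on_le[of _ K "{..<m - 1}"] by fastforce
    then show False using K(3) m by simp
  qed
  \<comment> \<open>An \<open>m\<close>-clique of \<open>B\<close> is not contained in
    \<open>A\<close>, so it meets \<open>A\<close> in at most \<open>m - 1\<close> vertices, and the
    available colours can tell these apart. Such colourings embed \<open>A\<close> in the
    cover.\<close>
  moreover have "\<exists>c. inj_on c (U \<inter> A) \<and> c ` (U \<inter> A) \<subseteq> {..<m - 1}" if U: "U \<in> Q" for U
  proof -
    have fU: "finite U" using U B(1) by (auto simp: Q_def intro: finite_subset)
    have "\<not> U \<subseteq> A" using U free fU by (auto simp: Q_def clique_free_def)
    then have "U \<inter> A \<subset> U" by blast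
    then have "card (U \<inter> A) < m" using psubset_card_mono[OF fU] U by (simp add: Q_def)
    then have "card (U \<inter> A) \<le> card {..<m - 1}" by simp
    then show ?thesis using card_le_inj[of "U \<inter> A" "{..<m - 1}"] fU by auto
  qed
  then obtain c where c: "\<And>U. U \<in> Q \<Longrightarrow> inj_on (c U) (U \<inter> A)"
    "\<And>U. U \<in> Q \<Longrightarrow> c U ` (U \<inter> A) \<subseteq> {..<m - 1}" by metis
  define i where "i x = (x, \<lambda>U\<in>Qv x. c U x)" for x
  have iW: "i ` A \<subseteq> W"
  proof
    fix a assume "a \<in> i ` A"
    then obtain x where x: "x \<in> A" "a = i x" by blast
    have "c U x \<in> {..<m - 1}" if "U \<in> Qv x" for U
      using c(2)[of U] that x(1) by (auto simp: Qv_def)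
    then show "a \<in> W" using x AB by (auto simp: i_def W_def)
  qed
  moreover have "inj_on i A" by (simp add: i_def inj_on_def)
  moreover have "(i x, i y) \<in> E \<longleftrightarrow> (x, y) \<in> F" if "x \<in> A" "y \<in> A" for x y
  proof -
    have "c U x \<noteq> c U y" if "(x, y) \<in> F" "U \<in> Q" "x \<in> U" "y \<in> U" for U
    proof -
      have "x \<noteq> y" using that(1) irF by (auto simp: irrefl_def)
      then show ?thesis using c(1)[OF that(2)] that \<open>x \<in> A\<close> \<open>y \<in> A\<close> by (auto simp: inj_on_def)
    qed
    moreover have "i x \<in> W" "i y \<in> W" using iW that by auto
    ultimately show ?thesis unfolding i_def E_iff by (auto simp: Qv_def)
  qed
  moreover have "\<exists>\<Theta>. graph_isomorphism \<Theta> W E W E \<and> (\<forall>x\<in>D. \<Theta> (i x) = i (\<theta> x))"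
    if \<theta>: "graph_isomorphism \<theta> B F B F" and D: "D \<subseteq> A" "\<theta> ` D \<subseteq> A" for \<theta> D
  proof -
    have \<theta>_bij: "inj_on \<theta> B" "\<theta> ` B = B" and \<theta>F: "\<And>x y. x \<in> B \<Longrightarrow> y \<in> B \<Longrightarrow> (\<theta> x, \<theta> y) \<in> F \<longleftrightarrow> (x, y) \<in> F"
      using \<theta> by (auto simp: graph_isomorphism_def bij_betw_def)
    have \<theta>_eq: "\<theta> x = \<theta> y \<longleftrightarrow> x = y" if "x \<in> B" "y \<in> B" for x y
      using \<theta>_bij(1) that by (auto simp: inj_on_def)
    define pre where "pre U = {x \<in> B. \<theta> x \<in> U}" for U
    have pre_image: "pre (\<theta> ` U) = U" if "U \<subseteq> B" for U
      using that \<theta>_eq by (auto simp: pre_def)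
    have image_pre: "\<theta> ` pre U = U" if "U \<subseteq> B" for U
      using that \<theta>_bij(2) by (auto simp: pre_def)
    have card_\<theta>: "card (\<theta> ` U) = card U" if "U \<subseteq> B" for U
      using card_image[OF inj_on_subset[OF \<theta>_bij(1) that]] .
    have clique_\<theta>: "clique F (\<theta> ` U) \<longleftrightarrow> clique F U" if "U \<subseteq> B" for U
    proof -
      have "(\<theta> x \<noteq> \<theta> y \<longrightarrow> (\<theta> x, \<theta> y) \<in> F) \<longleftrightarrow> (x \<noteq> y \<longrightarrow> (x, y) \<in> F)" if "x \<in> U" "y \<in> U" for x y
        using \<theta>_eq \<theta>F that \<open>U \<subseteq> B\<close> by (meson subsetD)
      then show ?thesis by (simp add: clique_def)
    qed
    have image_Q: "\<theta> ` U \<in> Q" if "U \<in> Q" for U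
      using that card_\<theta>[of U] clique_\<theta>[of U] \<theta>_bij(2) by (auto simp: Q_def)
    have pre_Q: "pre U \<in> Q" if "U \<in> Q" for U
    proof -
      have U: "U \<subseteq> B" "card U = m" "clique F U" using that by (auto simp: Q_def)
      have "pre U \<subseteq> B" by (auto simp: pre_def)
      then show ?thesis using card_\<theta>[of "pre U"] clique_\<theta>[of "pre U"] U image_pre[OF U(1)]
        by (simp add: Q_def)
    qed
    \<comment> \<open>At each clique the colours given to \<open>D\<close> must go to those of the
      image under \<open>\<theta>\<close>. Both colourings are injective on vertices of
      \<open>A\<close>, so this prescribes a partial injection of the colours, which extends to a
      permutation.\<close>
    have "\<exists>\<pi>. bij_betw \<pi> {..<m - 1} {..<m - 1} \<and> (\<forall>x\<in>U \<inter> D. \<pi> (c U x) = c (\<theta> ` U) (\<theta> x))"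
      if U: "U \<in> Q" for U
    proof -
      have UB: "U \<subseteq> B" using U by (simp add: Q_def)
      have inj: "inj_on (c U) (U \<inter> D)" using c(1)[OF U] by (rule inj_on_subset) (use D in auto)
      define \<phi> where "\<phi> k = c (\<theta> ` U) (\<theta> (inv_into (U \<inter> D) (c U) k))" for k
      have \<phi>: "\<phi> (c U x) = c (\<theta> ` U) (\<theta> x)" if "x \<in> U \<inter> D" for x
        using that inj by (simp add: \<phi>_def)
      have mem: "\<theta> x \<in> \<theta> ` U \<inter> A" if "x \<in> U \<inter> D" for x using that D by auto
      have inj_\<phi>: "inj_on \<phi> (c U ` (U \<inter> D))"
      proof (rule inj_onI)
        fix k l assume "k \<in> c U ` (U \<inter> D)" "l \<in> c U ` (U \<inter> D)" and eq: "\<phi> k = \<phi> l"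
        then obtain x y where xy: "x \<in> U \<inter> D" "y \<in> U \<inter> D" "k = c U x" "l = c U y" by blast
        then have "\<theta> x = \<theta> y"
          using eq \<phi> inj_onD[OF c(1)[OF image_Q[OF U]] _ mem[OF xy(1)] mem[OF xy(2)]] by simp
        then show "k = l" using \<theta>_eq xy UB by auto
      qed
      have "c U ` (U \<inter> D) \<subseteq> {..<m - 1}" using c(2)[OF U] D by blast
      moreover have "\<phi> ` c U ` (U \<inter> D) \<subseteq> {..<m - 1}"
        using c(2)[OF image_Q[OF U]] \<phi> mem by fastforce
      ultimately obtain \<pi> where "bij_betw \<pi> {..<m - 1} {..<m - 1}"
        "\<And>k. k \<in> c U ` (U \<inter> D) \<Longrightarrow> \<pi> k = \<phi> k"
        using extend_to_permutation[of "{..<m - 1}" "c U ` (U \<inter> D)" \<phi>] inj_\<phi> by blast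
      then show ?thesis using \<phi> by auto
    qed
    then obtain \<pi> where \<pi>: "\<And>U. U \<in> Q \<Longrightarrow> bij_betw (\<pi> U) {..<m - 1} {..<m - 1}"
      "\<And>U x. U \<in> Q \<Longrightarrow> x \<in> U \<inter> D \<Longrightarrow> \<pi> U (c U x) = c (\<theta> ` U) (\<theta> x)" by metis
    have \<pi>_eq: "\<pi> U k = \<pi> U l \<longleftrightarrow> k = l" if "U \<in> Q" "k \<in> {..<m - 1}" "l \<in> {..<m - 1}" for U k l
      using \<pi>(1)[OF that(1)] that(2,3) by (auto simp: bij_betw_def inj_on_def)
    \<comment> \<open>All vertices of a clique use the same permutation of its colours. This
      preserves equality and inequality of colours at the clique, hence adjacency in the
      cover.\<close>
    define re where "re v \<chi> = (\<lambda>U\<in>Qv (\<theta> v). \<pi> (pre U) (\<chi> (pre U)))" for v and \<chi> :: "'b set \<Rightarrow> nat"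
    define \<Theta> where "\<Theta> = (\<lambda>(v, \<chi>). (\<theta> v, re v \<chi>))"
    have W_colour: "\<chi> U \<in> {..<m - 1}" if "(v, \<chi>) \<in> W" "U \<in> Q" "v \<in> U" for v \<chi> U
      using that by (auto simp: W_def Qv_def PiE_def Pi_def)
    have re: "re v \<chi> (\<theta> ` U) = \<pi> U (\<chi> U)" if "U \<in> Q" "v \<in> U" for v \<chi> U
      using that image_Q[OF that(1)] pre_image[of U] by (auto simp: re_def Qv_def Q_def)
    have \<Theta>W: "\<Theta> (v, \<chi>) \<in> W" if v: "(v, \<chi>) \<in> W" for v \<chi>
    proof -
      have vB: "v \<in> B" using v by (simp add: W_def)
      have "\<pi> (pre U) (\<chi> (pre U)) \<in> {..<m - 1}" if "U \<in> Qv (\<theta> v)" for U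
      proof -
        have "pre U \<in> Q" "v \<in> pre U" using that vB pre_Q by (auto simp: Qv_def pre_def)
        then show ?thesis using W_colour[OF v, of "pre U"] \<pi>(1)[of "pre U"] by (auto simp: bij_betw_def)
      qed
      moreover have "\<theta> v \<in> B" using vB \<theta>_bij(2) by blast
      ultimately show ?thesis by (auto simp: \<Theta>_def W_def re_def)
    qed
    have "graph_isomorphism \<Theta> W E W E"
    proof (rule graph_isomorphism_finiteI[OF W])
      show "\<Theta> ` W \<subseteq> W" using \<Theta>W by auto
      show "inj_on \<Theta> W"
      proof (rule inj_onI)
        fix a b assume ab: "a \<in> W" "b \<in> W" "\<Theta> a = \<Theta> b"
        obtain v \<chi> w \<xi> where vw: "a = (v, \<chi>)" "b = (w, \<xi>)" by (cases a, cases b)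
        then have B: "v \<in> B" "w \<in> B" using ab by (auto simp: W_def)
        have "v = w" and eq: "re v \<chi> = re w \<xi>" using ab(3) \<theta>_eq[OF B] by (auto simp: \<Theta>_def vw)
        have "\<chi> = \<xi>"
        proof (rule PiE_ext[of _ "Qv v" "\<lambda>_. {..<m - 1}"])
          show "\<chi> \<in> Qv v \<rightarrow>\<^sub>E {..<m - 1}" "\<xi> \<in> Qv v \<rightarrow>\<^sub>E {..<m - 1}"
            using ab \<open>v = w\<close> by (auto simp: vw W_def)
          fix U assume "U \<in> Qv v"
          then have U: "U \<in> Q" "v \<in> U" by (auto simp: Qv_def)
          then have "\<pi> U (\<chi> U) = \<pi> U (\<xi> U)"
            using re[OF U, of \<chi>] re[OF U, of \<xi>] eq \<open>v = w\<close> by simp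
          then show "\<chi> U = \<xi> U"
            using \<pi>_eq[OF U(1)] W_colour ab(1,2) U \<open>v = w\<close> unfolding vw by blast
        qed
        then show "a = b" using vw \<open>v = w\<close> by simp
      qed
      fix a b assume ab: "a \<in> W" "b \<in> W"
      obtain v \<chi> w \<xi> where vw: "a = (v, \<chi>)" "b = (w, \<xi>)" by (cases a, cases b)
      then have B: "v \<in> B" "w \<in> B" using ab by (auto simp: W_def)
      have "(\<forall>U\<in>Q. \<theta> v \<in> U \<and> \<theta> w \<in> U \<longrightarrow> re v \<chi> U \<noteq> re w \<xi> U) \<longleftrightarrow>
          (\<forall>U\<in>Q. v \<in> U \<and> w \<in> U \<longrightarrow> \<chi> U \<noteq> \<xi> U)" (is "?l = ?r")
      proof
        assume l: ?l
        show ?r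
        proof (intro ballI impI notI)
          fix U assume U: "U \<in> Q" "v \<in> U \<and> w \<in> U" "\<chi> U = \<xi> U"
          then have "re v \<chi> (\<theta> ` U) = re w \<xi> (\<theta> ` U)" using re by simp
          then show False using l image_Q[OF U(1)] U(2) by blast
        qed
      next
        assume r: ?r
        show ?l
        proof (intro ballI impI notI)
          fix U assume U: "U \<in> Q" "\<theta> v \<in> U \<and> \<theta> w \<in> U" "re v \<chi> U = re w \<xi> U"
          define U' where "U' = pre U"
          have U': "U' \<in> Q" "v \<in> U'" "w \<in> U'" using U B pre_Q by (auto simp: U'_def pre_def)
          have "\<theta> ` U' = U" using U(1) image_pre by (simp add: U'_def Q_def)
          then have "\<pi> U' (\<chi> U') = \<pi> U' (\<xi> U')"
            using U(3) re[OF U'(1,2), of \<chi>] re[OF U'(1,3), of \<xi>] by simp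
          then have "\<chi> U' = \<xi> U'" using \<pi>_eq[OF U'(1)] W_colour ab U' unfolding vw by blast
          then show False using r U' by blast
        qed
      qed
      then show "(\<Theta> a, \<Theta> b) \<in> E \<longleftrightarrow> (a, b) \<in> E"
        using ab \<Theta>W[of v \<chi>] \<Theta>W[of w \<xi>] \<theta>F[OF B] unfolding vw by (simp add: \<Theta>_def E_iff)
    qed
    moreover have "\<Theta> (i x) = i (\<theta> x)" if x: "x \<in> D" for x
    proof -
      have xB: "x \<in> B" using x D AB by blast
      have "re x (\<lambda>U\<in>Qv x. c U x) U = c U (\<theta> x)" if U: "U \<in> Qv (\<theta> x)" for U
      proof -
        have UQ: "U \<in> Q" "U \<subseteq> B" using U by (auto simp: Qv_def Q_def)
        have p: "pre U \<in> Q" "x \<in> pre U" using U xB pre_Q by (auto simp: Qv_def pre_def)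
        then have "re x (\<lambda>U\<in>Qv x. c U x) (\<theta> ` pre U) = \<pi> (pre U) (c (pre U) x)"
          using re[OF p] by (simp add: Qv_def)
        also have "\<dots> = c (\<theta> ` pre U) (\<theta> x)" using \<pi>(2)[OF p(1)] p(2) x by blast
        finally show ?thesis using image_pre[OF UQ(2)] by simp
      qed
      then have "re x (\<lambda>U\<in>Qv x. c U x) = (\<lambda>U\<in>Qv (\<theta> x). c U (\<theta> x))"
        by (intro ext) (simp add: re_def restrict_def)
      then show ?thesis by (simp add: \<Theta>_def i_def)
    qed
    ultimately show ?thesis by blast
  qed
  ultimately show ?thesis using W by (intro that[of W E i]) auto
qed

text \<open>The first extension may create \<open>m\<close>-cliques; the cover removes them and
  lifts automorphisms. A partial isomorphism becomes an automorphism of the intermediate graph that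
  maps the copy of \<open>D\<close> into the copy of \<open>A\<close>, which is what the cover asks
  for.\<close>

lemma clique_free_eppa:
  fixes A :: "'a set"
  assumes A: "finite A" and E: "sym E" "irrefl E" and free: "clique_free m A E" and m: "m \<ge> 1"
  obtains W :: "(('a \<times> 'a set) \<times> (('a \<times> 'a set) set \<Rightarrow> nat)) set" and F i where
    "finite W" "graph W F" "clique_free m W F" "inj_on i A" "i ` A \<subseteq> W"
    "\<And>x y. x \<in> A \<Longrightarrow> y \<in> A \<Longrightarrow> (i x, i y) \<in> F \<longleftrightarrow> (x, y) \<in> E"
    "\<And>D p. partial_isomorphism E A D p \<Longrightarrow>
       \<exists>\<theta>. graph_isomorphism \<theta> W F W F \<and> (\<forall>x\<in>D. \<theta> (i x) = i (p x))"
proof -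
  obtain B :: "('a \<times> 'a set) set" and F j where B: "finite B" "graph B F"
    and j: "inj_on j A" "j ` A \<subseteq> B"
    "\<And>x y. x \<in> A \<Longrightarrow> y \<in> A \<Longrightarrow> (j x, j y) \<in> F \<longleftrightarrow> (x, y) \<in> E"
    and ext: "\<And>D p. partial_isomorphism E A D p \<Longrightarrow>
       \<exists>\<theta>. graph_isomorphism \<theta> B F B F \<and> (\<forall>x\<in>D. \<theta> (j x) = j (p x))"
    using graph_eppa[OF A E] by metis
  have free': "clique_free m (j ` A) F"
  proof (rule clique_free_embedding[OF free])
    show "inj_on (inv_into A j) (j ` A)" by (rule inj_on_inv_into) simp
    show "inv_into A j ` j ` A \<subseteq> A" using j(1) by auto
    show "(inv_into A j x, inv_into A j y) \<in> E" if "x \<in> j ` A" "y \<in> j ` A" "(x, y) \<in> F" for x y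
      using that j(1,3) by auto
  qed
  obtain W :: "(('a \<times> 'a set) \<times> (('a \<times> 'a set) set \<Rightarrow> nat)) set" and E' i where
    W: "finite W" "graph W E'" "clique_free m W E'" and i: "inj_on i (j ` A)" "i ` j ` A \<subseteq> W"
    "\<And>x y. x \<in> j ` A \<Longrightarrow> y \<in> j ` A \<Longrightarrow> (i x, i y) \<in> E' \<longleftrightarrow> (x, y) \<in> F"
    and ext': "\<And>\<theta> D. graph_isomorphism \<theta> B F B F \<Longrightarrow> D \<subseteq> j ` A \<Longrightarrow> \<theta> ` D \<subseteq> j ` A \<Longrightarrow>
       \<exists>\<Theta>. graph_isomorphism \<Theta> W E' W E' \<and> (\<forall>x\<in>D. \<Theta> (i x) = i (\<theta> x))"
    using clique_free_cover[OF B j(2) free' m] by metis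
  show ?thesis
  proof (rule that[OF W, of "i \<circ> j"])
    show "inj_on (i \<circ> j) A" using j(1) i(1) by (rule comp_inj_on)
    show "(i \<circ> j) ` A \<subseteq> W" using i(2) by auto
    show "((i \<circ> j) x, (i \<circ> j) y) \<in> E' \<longleftrightarrow> (x, y) \<in> E" if "x \<in> A" "y \<in> A" for x y
      using that i(3) j(3) by simp
    show "\<exists>\<theta>. graph_isomorphism \<theta> W E' W E' \<and> (\<forall>x\<in>D. \<theta> ((i \<circ> j) x) = (i \<circ> j) (p x))"
      if p: "partial_isomorphism E A D p" for D p
    proof -
      obtain \<theta> where \<theta>: "graph_isomorphism \<theta> B F B F" "\<forall>x\<in>D. \<theta> (j x) = j (p x)"
        using ext[OF p] by blast
      have "D \<subseteq> A" "p ` D \<subseteq> A" using p by (auto simp: partial_isomorphism_def)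
      then have D: "j ` D \<subseteq> j ` A" "\<theta> ` j ` D \<subseteq> j ` A" using \<theta>(2) by auto
      obtain \<Theta> where "graph_isomorphism \<Theta> W E' W E'" "\<forall>x\<in>j ` D. \<Theta> (i x) = i (\<theta> x)"
        using ext'[OF \<theta>(1) D] by blast
      then show ?thesis using \<theta>(2) by (intro exI[of _ \<Theta>]) auto
    qed
  qed
qed

section \<open>The generic graph\<close>

text \<open>Automorphisms as permutations of the whole type that fix everything outside \<open>V\<close>, so that
  \<open>\<circ>\<close> and \<open>pinv\<close> are the group operations.\<close>

definition total_auts :: "'a set \<Rightarrow> 'a rel \<Rightarrow> ('a \<Rightarrow> 'a) set" where
  "total_auts V E = {f. bij f \<and> (\<forall>x. x \<notin> V \<longrightarrow> f x = x) \<and> (\<forall>x y. (f x, f y) \<in> E \<longleftrightarrow> (x, y) \<in> E)}"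

lemma total_autsD:
  assumes "f \<in> total_auts V E"
  shows "bij f" "x \<notin> V \<Longrightarrow> f x = x" "(f x, f y) \<in> E \<longleftrightarrow> (x, y) \<in> E" "f x = f y \<longleftrightarrow> x = y"
    "f x \<in> V \<longleftrightarrow> x \<in> V" "f (pinv f x) = x" "pinv f (f x) = x"
proof -
  show bij: "bij f" and out: "x \<notin> V \<Longrightarrow> f x = x" for x
    using assms by (auto simp: total_auts_def)
  show "(f x, f y) \<in> E \<longleftrightarrow> (x, y) \<in> E" using assms by (simp add: total_auts_def)
  show inj: "f x = f y \<longleftrightarrow> x = y" for x y using bij by (auto simp: bij_def inj_def)
  show "f (pinv f x) = x" "pinv f (f x) = x"
    using bij by (simp_all add: bij_is_surj surj_f_inv_f bij_is_inj)
  show "f x \<in> V \<longleftrightarrow> x \<in> V"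
    using out[of x] out[of "f x"] inj[of "f x" x] by metis
qed

lemma carrier_graph_aut: "carrier (graph_aut V E) = {f \<in> Bij V. graph_isomorphism f V E V E}"
  by (simp add: graph_aut_def)

lemma restrict_total_aut:
  assumes "f \<in> total_auts V E"
  shows "restrict f V \<in> carrier (graph_aut V E)"
proof -
  note f = total_autsD[OF assms]
  have "f ` V = V"
  proof
    show "f ` V \<subseteq> V" using f(5) by auto
    show "V \<subseteq> f ` V"
    proof
      fix x assume "x \<in> V"
      then have "pinv f x \<in> V" using f(5)[of "pinv f x"] f(6)[of x] by simp
      then show "x \<in> f ` V" using f(6)[of x] by (metis imageI)
    qed
  qed
  moreover have "inj_on f V" using f(4) by (simp add: inj_on_def)
  ultimately have "bij_betw (restrict f V) V V" by (simp add: bij_betw_def)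
  then show ?thesis using f(3) by (simp add: carrier_graph_aut Bij_def graph_isomorphism_def)
qed

lemma extend_graph_aut:
  assumes "g \<in> carrier (graph_aut V E)" and "E \<subseteq> V \<times> V"
  shows "(\<lambda>x. if x \<in> V then g x else x) \<in> total_auts V E"
proof -
  let ?f = "\<lambda>x. if x \<in> V then g x else x"
  have g: "bij_betw g V V" "\<And>x y. x \<in> V \<Longrightarrow> y \<in> V \<Longrightarrow> (g x, g y) \<in> E \<longleftrightarrow> (x, y) \<in> E"
    using assms(1) by (auto simp: carrier_graph_aut graph_isomorphism_def)
  then have gV: "g x \<in> V" if "x \<in> V" for x using that by (auto simp: bij_betw_def)
  have "bij_betw ?f V V" using g(1) by (rule bij_betw_cong[THEN iffD1, rotated]) simp
  moreover have "bij_betw ?f (- V) (- V)" by (rule bij_betwI[where g = id]) auto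
  ultimately have "bij_betw ?f (V \<union> - V) (V \<union> - V)" by (rule bij_betw_combine) blast
  then have "bij ?f" by simp
  moreover have "(?f x, ?f y) \<in> E \<longleftrightarrow> (x, y) \<in> E" for x y
    using g(2)[of x y] gV assms(2) by auto
  ultimately show ?thesis by (simp add: total_auts_def)
qed

lemma mult_restrict:
  assumes "f \<in> total_auts V E" "g \<in> total_auts V E"
  shows "restrict f V \<otimes>\<^bsub>graph_aut V E\<^esub> restrict g V = restrict (f \<circ> g) V"
proof -
  have "restrict f V \<in> Bij V" "restrict g V \<in> Bij V"
    using restrict_total_aut[OF assms(1)] restrict_total_aut[OF assms(2)]
    by (auto simp: carrier_graph_aut)
  then show ?thesis using total_autsD(5)[OF assms(2)]
    by (auto simp: graph_aut_def BijGroup_def compose_def)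
qed

section \<open>Extension and amalgamation inside the generic graph\<close>

locale generic_graph =
  fixes m :: nat and V :: "'a set" and E :: "'a rel"
  assumes m: "m \<ge> 1" and generic_graph: "generic_complete_free_graph m V E"
begin

abbreviation "T \<equiv> total_auts V E"

lemma E_subset: "E \<subseteq> V \<times> V" and E_sym: "sym E" and E_irrefl: "irrefl E"
  and countable_V: "countable V"
  using generic_graph by (auto simp: generic_complete_free_graph_def graph_def)

lemma homogeneous:
  assumes "finite A" "A \<subseteq> V" "inj_on p A" "p ` A \<subseteq> V"
    and p: "\<And>x y. x \<in> A \<Longrightarrow> y \<in> A \<Longrightarrow> (p x, p y) \<in> E \<longleftrightarrow> (x, y) \<in> E"
  obtains g where "g \<in> T" "\<And>x. x \<in> A \<Longrightarrow> g x = p x"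
proof -
  have "graph_isomorphism p A (induced_edges E A) (p ` A) (induced_edges E (p ` A))"
    using assms(3) p by (auto simp: graph_isomorphism_def bij_betw_def induced_edges_def)
  moreover have "homogeneous_graph V E"
    using generic_graph by (simp add: generic_complete_free_graph_def)
  ultimately have "\<exists>g\<in>carrier (graph_aut V E). \<forall>x\<in>A. g x = p x"
    using assms(1,2,4) unfolding homogeneous_graph_def by blast
  then obtain g where g: "g \<in> carrier (graph_aut V E)" "\<And>x. x \<in> A \<Longrightarrow> g x = p x" by blast
  show ?thesis
  proof (rule that[OF extend_graph_aut[OF g(1) E_subset]])
    show "(if x \<in> V then g x else x) = p x" if "x \<in> A" for x
      using g(2)[OF that] that assms(2) by auto
  qed
qed

lemma clique_free_subset:
  assumes "finite S" "S \<subseteq> V"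
  shows "clique_free m S E"
proof -
  have "complete_free m S (induced_edges E S)"
    using assms generic_graph by (auto simp: generic_complete_free_graph_def)
  then have free: "clique_free m S (induced_edges E S)"
    using complete_free_iff_clique_free[of "induced_edges E S"] E_irrefl
    by (auto simp: induced_edges_def irrefl_def)
  show ?thesis
    by (rule clique_free_embedding[OF free, of id]) (auto simp: induced_edges_def)
qed

text \<open>The age condition only yields some copy of \<open>W\<close>. Homogeneity supplies an
  automorphism that takes \<open>A\<close> to its image in this copy, and its inverse moves the copy
  to one that extends \<open>A\<close>.\<close>

lemma universal:
  fixes W :: "'w set"
  assumes W: "finite W" "graph W F" "clique_free m W F"
    and A: "finite A" "A \<subseteq> V" and i: "inj_on i A" "i ` A \<subseteq> W"
    "\<And>x y. x \<in> A \<Longrightarrow> y \<in> A \<Longrightarrow> (i x, i y) \<in> F \<longleftrightarrow> (x, y) \<in> E"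
  obtains j where "inj_on j W" "j ` W \<subseteq> V"
    "\<And>x y. x \<in> W \<Longrightarrow> y \<in> W \<Longrightarrow> (j x, j y) \<in> E \<longleftrightarrow> (x, y) \<in> F" "\<And>x. x \<in> A \<Longrightarrow> j (i x) = x"
proof -
  have FW: "F \<subseteq> W \<times> W" "sym F" "irrefl F" using W(2) by (auto simp: graph_def)
  \<comment> \<open>The age condition speaks of graphs on natural numbers, hence the renaming of
    vertices.\<close>
  obtain t :: "'w \<Rightarrow> nat" where t: "inj_on t W"
    using finite_imp_inj_to_nat_seg[OF W(1)] by blast
  have t_eq: "t x = t y \<longleftrightarrow> x = y" if "x \<in> W" "y \<in> W" for x y
    using t that by (auto simp: inj_on_def)
  define F' where "F' = (\<lambda>(x, y). (t x, t y)) ` F"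
  have F': "(t x, t y) \<in> F' \<longleftrightarrow> (x, y) \<in> F" if "x \<in> W" "y \<in> W" for x y
  proof
    assume "(t x, t y) \<in> F'"
    then obtain x' y' where xy: "(x', y') \<in> F" "t x = t x'" "t y = t y'" by (auto simp: F'_def)
    then have "x' \<in> W" "y' \<in> W" using FW(1) by auto
    then show "(x, y) \<in> F" using xy t_eq that by simp
  qed (force simp: F'_def)
  have "graph (t ` W) F'"
    unfolding graph_def
  proof (intro conjI)
    show "F' \<subseteq> t ` W \<times> t ` W" using FW(1) by (auto simp: F'_def)
    show "sym F'"
    proof (rule symI)
      fix a b assume "(a, b) \<in> F'"
      then obtain x y where "(x, y) \<in> F" "a = t x" "b = t y" by (auto simp: F'_def)
      moreover then have "(y, x) \<in> F" using FW(2) by (meson symD)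
      ultimately show "(b, a) \<in> F'" by (force simp: F'_def)
    qed
    show "irrefl F'"
    proof (rule irreflI)
      fix a show "(a, a) \<notin> F'"
      proof
        assume "(a, a) \<in> F'"
        then obtain x y where xy: "(x, y) \<in> F" "t x = t y" by (auto simp: F'_def)
        then have "x = y" using FW(1) t_eq by blast
        then show False using xy(1) FW(3) by (auto simp: irrefl_def)
      qed
    qed
  qed
  moreover have "clique_free m (t ` W) F'"
  proof (rule clique_free_embedding[OF W(3), of "inv_into W t"])
    show "inj_on (inv_into W t) (t ` W)" by (rule inj_on_inv_into) simp
    show "inv_into W t ` t ` W \<subseteq> W" using t by auto
    show "(inv_into W t x, inv_into W t y) \<in> F" if "x \<in> t ` W" "y \<in> t ` W" "(x, y) \<in> F'" for x y
      using that t F' by auto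
  qed
  ultimately have "\<exists>S f. S \<subseteq> V \<and> graph_isomorphism f (t ` W) F' S (induced_edges E S)"
    using generic_graph W(1) complete_free_iff_clique_free[of F' m "t ` W"]
    unfolding generic_complete_free_graph_def graph_def by blast
  then obtain S f where S: "S \<subseteq> V" and f: "graph_isomorphism f (t ` W) F' S (induced_edges E S)"
    by blast
  define h where "h = f \<circ> t"
  have h_inj: "inj_on h W" unfolding h_def
    using t f by (intro comp_inj_on) (auto simp: graph_isomorphism_def bij_betw_def)
  have hS: "h x \<in> S" if "x \<in> W" for x
    using f that by (auto simp: h_def graph_isomorphism_def bij_betw_def)
  have hE: "(h x, h y) \<in> E \<longleftrightarrow> (x, y) \<in> F" if "x \<in> W" "y \<in> W" for x y
  proof -
    have "(f (t x), f (t y)) \<in> induced_edges E S \<longleftrightarrow> (t x, t y) \<in> F'"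
      using f that by (simp add: graph_isomorphism_def)
    then show ?thesis using hS[OF that(1)] hS[OF that(2)] F'[OF that]
      by (simp add: h_def induced_edges_def)
  qed
  have iW: "i x \<in> W" if "x \<in> A" for x using i(2) that by blast
  obtain g where g: "g \<in> T" "\<And>x. x \<in> A \<Longrightarrow> g x = h (i x)"
  proof (rule homogeneous[OF A, of "\<lambda>x. h (i x)"])
    show "inj_on (\<lambda>x. h (i x)) A"
      using comp_inj_on[OF i(1) inj_on_subset[OF h_inj i(2)]] by (simp add: comp_def)
    show "(\<lambda>x. h (i x)) ` A \<subseteq> V" using iW hS S by blast
    show "(h (i x), h (i y)) \<in> E \<longleftrightarrow> (x, y) \<in> E" if "x \<in> A" "y \<in> A" for x y
      using hE[OF iW[OF that(1)] iW[OF that(2)]] i(3)[OF that] by simp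
  qed (rule that)
  note g' = total_autsD[OF g(1)]
  have g_inv: "(pinv g x, pinv g y) \<in> E \<longleftrightarrow> (x, y) \<in> E" "pinv g x \<in> V \<longleftrightarrow> x \<in> V"
    "pinv g x = pinv g y \<longleftrightarrow> x = y" for x y
    using g'(3)[of "pinv g x" "pinv g y"] g'(5)[of "pinv g x"] g'(6)[of x] g'(6)[of y]
    by (simp, simp, metis)
  show ?thesis
  proof (rule that[of "\<lambda>x. pinv g (h x)"])
    show "inj_on (\<lambda>x. pinv g (h x)) W" using h_inj g_inv(3) by (simp add: inj_on_def)
    show "(\<lambda>x. pinv g (h x)) ` W \<subseteq> V" using hS S g_inv(2) by blast
    show "(pinv g (h x), pinv g (h y)) \<in> E \<longleftrightarrow> (x, y) \<in> F" if "x \<in> W" "y \<in> W" for x y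
      using g_inv(1) hE[OF that] by simp
    show "pinv g (h (i x)) = x" if "x \<in> A" for x
      using g(2)[OF that] g'(7)[of x] by simp
  qed
qed

lemma extend_on_embedded:
  assumes W: "finite W" and j: "inj_on j W" "j ` W \<subseteq> V"
    "\<And>x y. x \<in> W \<Longrightarrow> y \<in> W \<Longrightarrow> (j x, j y) \<in> E \<longleftrightarrow> (x, y) \<in> F"
    and \<theta>: "inj_on \<theta> W" "\<theta> ` W \<subseteq> W" "\<And>x y. x \<in> W \<Longrightarrow> y \<in> W \<Longrightarrow> (\<theta> x, \<theta> y) \<in> F \<longleftrightarrow> (x, y) \<in> F"
  obtains g where "g \<in> T" "\<And>x. x \<in> W \<Longrightarrow> g (j x) = j (\<theta> x)"
proof -
  have \<theta>W: "\<theta> x \<in> W" if "x \<in> W" for x using \<theta>(2) that by blast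
  obtain g where g: "g \<in> T" "\<And>z. z \<in> j ` W \<Longrightarrow> g z = j (\<theta> (inv_into W j z))"
  proof (rule homogeneous[of "j ` W" "\<lambda>z. j (\<theta> (inv_into W j z))"])
    show "inj_on (\<lambda>z. j (\<theta> (inv_into W j z))) (j ` W)"
    proof (rule inj_onI)
      fix a b assume "a \<in> j ` W" "b \<in> j ` W"
        and eq: "j (\<theta> (inv_into W j a)) = j (\<theta> (inv_into W j b))"
      then obtain x y where xy: "x \<in> W" "y \<in> W" "a = j x" "b = j y" by blast
      then have "j (\<theta> x) = j (\<theta> y)" using eq j(1) by simp
      then have "\<theta> x = \<theta> y" using j(1) \<theta>W xy by (simp add: inj_on_eq_iff)
      then show "a = b" using \<theta>(1) xy by (simp add: inj_on_eq_iff)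
    qed
    show "(\<lambda>z. j (\<theta> (inv_into W j z))) ` j ` W \<subseteq> V" using j(1,2) \<theta>W by auto
    show "(j (\<theta> (inv_into W j x)), j (\<theta> (inv_into W j y))) \<in> E \<longleftrightarrow> (x, y) \<in> E"
      if "x \<in> j ` W" "y \<in> j ` W" for x y
      using that j(1,3) \<theta>(3) \<theta>W by auto
  qed (use W j(2) in \<open>auto intro: that\<close>)
  show ?thesis using that[OF g(1)] g(2) j(1) by auto
qed

text \<open>The finite extension of \<open>A \<inter> V\<close> lives on another type;
  \<open>universal\<close> embeds it back over \<open>A \<inter> V\<close>, and homogeneity extends
  its automorphisms to \<open>V\<close>. Points of \<open>A\<close> outside \<open>V\<close> are
  fixed by \<open>T\<close> and can simply be added.\<close>

lemma eppa:
  assumes A: "finite A"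
  shows "\<exists>C. finite C \<and> A \<subseteq> C \<and>
    (\<forall>p\<in>T. \<forall>D. D \<subseteq> A \<and> p ` D \<subseteq> A \<longrightarrow> (\<exists>q\<in>T. (\<forall>x\<in>D. q x = p x) \<and> q ` C = C))"
proof -
  have AV: "finite (A \<inter> V)" using A by simp
  obtain W :: "(('a \<times> 'a set) \<times> (('a \<times> 'a set) set \<Rightarrow> nat)) set" and F i where
    W: "finite W" "graph W F" "clique_free m W F" and i: "inj_on i (A \<inter> V)" "i ` (A \<inter> V) \<subseteq> W"
    "\<And>x y. x \<in> A \<inter> V \<Longrightarrow> y \<in> A \<inter> V \<Longrightarrow> (i x, i y) \<in> F \<longleftrightarrow> (x, y) \<in> E"
    and ext: "\<And>D p. partial_isomorphism E (A \<inter> V) D p \<Longrightarrow>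
       \<exists>\<theta>. graph_isomorphism \<theta> W F W F \<and> (\<forall>x\<in>D. \<theta> (i x) = i (p x))"
    by (rule clique_free_eppa[OF AV E_sym E_irrefl clique_free_subset[OF AV Int_lower2] m])
      (rule that)
  obtain j where j: "inj_on j W" "j ` W \<subseteq> V"
    "\<And>x y. x \<in> W \<Longrightarrow> y \<in> W \<Longrightarrow> (j x, j y) \<in> E \<longleftrightarrow> (x, y) \<in> F" "\<And>x. x \<in> A \<inter> V \<Longrightarrow> j (i x) = x"
    by (rule universal[OF W AV _ i]) auto
  have iW: "i x \<in> W" if "x \<in> A \<inter> V" for x using i(2) that by blast
  define C where "C = j ` W \<union> (A - V)"
  have AC: "A \<subseteq> C"
  proof
    fix x assume "x \<in> A"
    then show "x \<in> C" using j(4)[of x] iW[of x] by (cases "x \<in> V") (auto simp: C_def intro: rev_image_eqI)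
  qed
  have key: "\<exists>q\<in>T. (\<forall>x\<in>D. q x = p x) \<and> q ` C = C" if p: "p \<in> T" and D: "D \<subseteq> A" "p ` D \<subseteq> A" for p D
  proof -
    note p' = total_autsD[OF p]
    have pA: "p x \<in> A \<inter> V" if "x \<in> D \<inter> V" for x using that D p'(5) by auto
    have "partial_isomorphism E (A \<inter> V) (D \<inter> V) p"
      using D p'(3,4) pA by (auto simp: partial_isomorphism_def inj_on_def)
    then obtain \<theta> where \<theta>: "graph_isomorphism \<theta> W F W F" "\<And>x. x \<in> D \<inter> V \<Longrightarrow> \<theta> (i x) = i (p x)"
      using ext by blast
    then have \<theta>': "inj_on \<theta> W" "\<theta> ` W = W"
      "\<And>x y. x \<in> W \<Longrightarrow> y \<in> W \<Longrightarrow> (\<theta> x, \<theta> y) \<in> F \<longleftrightarrow> (x, y) \<in> F"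
      by (auto simp: graph_isomorphism_def bij_betw_def)
    obtain q where q: "q \<in> T" "\<And>x. x \<in> W \<Longrightarrow> q (j x) = j (\<theta> x)"
      by (rule extend_on_embedded[OF W(1) j(1-3) \<theta>'(1) _ \<theta>'(3)]) (use \<theta>'(2) in auto)
    have "q x = p x" if x: "x \<in> D" for x
    proof (cases "x \<in> V")
      case True
      then have xA: "x \<in> A \<inter> V" using x D by auto
      then have "q x = j (\<theta> (i x))" using q(2)[OF iW[OF xA]] j(4)[OF xA] by simp
      also have "\<dots> = p x" using \<theta>(2)[of x] x True j(4)[OF pA[of x]] by simp
      finally show ?thesis .
    next
      case False
      then show ?thesis using total_autsD(2)[OF q(1)] p'(2) by simp
    qed
    moreover have "q ` j ` W = j ` W"
      by (rule image_conjugate[where g = \<theta>]) (use \<theta>'(2) q(2) in simp_all)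
    moreover have "q ` (A - V) = A - V" using total_autsD(2)[OF q(1)] by force
    ultimately have "q ` C = C" "\<forall>x\<in>D. q x = p x" by (simp_all add: C_def image_Un)
    then show ?thesis using q(1) by (intro bexI[of _ q] conjI)
  qed
  have "finite C" using W(1) A by (simp add: C_def)
  show ?thesis
    by (intro exI[of _ C] conjI ballI allI impI \<open>finite C\<close> AC key) simp_all
qed

text \<open>The amalgam consists of \<open>D\<close> (tag \<open>False\<close>) and \<open>C - B\<close> (tag \<open>True\<close>), with no edges between
  \<open>C - B\<close> and \<open>D - B\<close>.\<close>

lemma amalgamation:
  assumes fin: "finite C" "finite D" and B: "B \<subseteq> C" "B \<subseteq> D"
  shows "\<exists>e\<in>T. (\<forall>x\<in>B. e x = x) \<and>
    (\<forall>c\<in>T. \<forall>d\<in>T. c ` C = C \<and> d ` D = D \<and> c ` B = B \<and> (\<forall>x\<in>B. c x = d x) \<longrightarrow>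
       (\<exists>f\<in>T. (\<forall>x\<in>D. f x = d x) \<and> (\<forall>x\<in>C. f (e x) = e (c x))))"
proof -
  define W where "W = (D \<inter> V) \<times> {False} \<union> ((C - B) \<inter> V) \<times> {True}"
  define F where "F = {((x, b), (y, b')). (x, b) \<in> W \<and> (y, b') \<in> W \<and> (x, y) \<in> E \<and> (b = b' \<or> x \<in> B \<or> y \<in> B)}"
  have F_iff: "((x, b), (y, b')) \<in> F \<longleftrightarrow>
      (x, b) \<in> W \<and> (y, b') \<in> W \<and> (x, y) \<in> E \<and> (b = b' \<or> x \<in> B \<or> y \<in> B)" for x b y b'
    by (simp add: F_def)
  have W_iff: "(x, False) \<in> W \<longleftrightarrow> x \<in> D \<and> x \<in> V" "(x, True) \<in> W \<longleftrightarrow> x \<in> C \<and> x \<notin> B \<and> x \<in> V" for x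
    by (auto simp: W_def)
  have E_commute: "(x, y) \<in> E \<longleftrightarrow> (y, x) \<in> E" for x y using E_sym by (auto simp: sym_def)
  have W: "finite W" using fin by (simp add: W_def)
  have "graph W F" unfolding graph_def
  proof (intro conjI)
    show "F \<subseteq> W \<times> W" by (auto simp: F_def)
    show "sym F" unfolding sym_def F_def using E_commute by auto
    show "irrefl F" using E_irrefl by (auto simp: F_def irrefl_def)
  qed
  moreover have "clique_free m W F"
    unfolding clique_free_def
  proof (intro allI impI notI)
    fix U assume U: "U \<subseteq> W" "finite U" "card U = m" "clique F U"
    \<comment> \<open>Forgetting the tag is a homomorphism to the original graph, and the absence of
      loops makes it injective on cliques. A clique of the amalgam would thus give one of the same
      size in \<open>V\<close>.\<close>
    have adj: "(fst a, fst b) \<in> E" if "a \<in> U" "b \<in> U" "a \<noteq> b" for a b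
      using U(4) that unfolding clique_def F_def by fastforce
    have "inj_on fst U"
    proof (rule inj_onI, rule ccontr)
      fix a b assume "a \<in> U" "b \<in> U" "fst a = fst b" "a \<noteq> b"
      then show False using adj[of a b] E_irrefl by (simp add: irrefl_def)
    qed
    moreover have "fst ` U \<subseteq> V" using U(1) by (auto simp: W_def)
    moreover have "finite (fst ` U)" using U(2) by simp
    moreover have "clique E (fst ` U)" unfolding clique_def using adj by blast
    ultimately show False
      using clique_free_subset[of "fst ` U"] U(3) by (auto simp: clique_free_def card_image)
  qed
  moreover have "finite (D \<inter> V)" "D \<inter> V \<subseteq> V" using fin by auto
  moreover have "inj_on (\<lambda>x. (x, False)) (D \<inter> V)" by (simp add: inj_on_def)
  moreover have "(\<lambda>x. (x, False)) ` (D \<inter> V) \<subseteq> W" by (auto simp: W_def)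
  moreover have "((x, False), (y, False)) \<in> F \<longleftrightarrow> (x, y) \<in> E" if "x \<in> D \<inter> V" "y \<in> D \<inter> V" for x y
    using that by (simp add: F_iff W_iff)
  ultimately obtain j where j: "inj_on j W" "j ` W \<subseteq> V"
    "\<And>x y. x \<in> W \<Longrightarrow> y \<in> W \<Longrightarrow> (j x, j y) \<in> E \<longleftrightarrow> (x, y) \<in> F"
    "\<And>x. x \<in> D \<inter> V \<Longrightarrow> j (x, False) = x"
    using universal[OF W, of F "D \<inter> V" "\<lambda>x. (x, False)"] by blast
  \<comment> \<open>The inclusion of \<open>C\<close> in the amalgam: points of \<open>B\<close>
    take the tag of \<open>D\<close>, which identifies the two copies of \<open>B\<close>.\<close>
  define n where "n x = (x, x \<notin> B)" for x
  have nW: "n x \<in> W" if "x \<in> C \<inter> V" for x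
    using that B by (auto simp: n_def W_def)
  obtain e where e: "e \<in> T" "\<And>x. x \<in> C \<inter> V \<Longrightarrow> e x = j (n x)"
  proof (rule homogeneous[of "C \<inter> V" "\<lambda>x. j (n x)"])
    show "inj_on (\<lambda>x. j (n x)) (C \<inter> V)"
      using j(1) nW by (auto simp: inj_on_def n_def)
    show "(j (n x), j (n y)) \<in> E \<longleftrightarrow> (x, y) \<in> E" if "x \<in> C \<inter> V" "y \<in> C \<inter> V" for x y
      using j(3)[OF nW[OF that(1)] nW[OF that(2)]] nW[OF that(1)] nW[OF that(2)]
      by (auto simp: n_def F_iff)
  qed (use fin nW j(2) in \<open>auto intro: that\<close>)
  note e' = total_autsD[OF e(1)]
  have eB: "e x = x" if "x \<in> B" for x
  proof (cases "x \<in> V")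
    case True
    then have "x \<in> C \<inter> V" "x \<in> D \<inter> V" using that B by auto
    then show ?thesis using e(2)[of x] j(4)[of x] that by (simp add: n_def)
  qed (use e'(2) in simp)
  have "\<exists>f\<in>T. (\<forall>x\<in>D. f x = d x) \<and> (\<forall>x\<in>C. f (e x) = e (c x))"
    if c: "c \<in> T" and d: "d \<in> T" and inv: "c ` C = C" "d ` D = D" "c ` B = B"
      and cd: "\<forall>x\<in>B. c x = d x" for c d
  proof -
    note c' = total_autsD[OF c] and d' = total_autsD[OF d]
    have memC: "c x \<in> C \<longleftrightarrow> x \<in> C" "c x \<in> B \<longleftrightarrow> x \<in> B" for x
      using inj_image_mem_iff[OF bij_is_inj[OF c'(1)]] inv(1,3) by metis+
    have "d ` B = c ` B" using cd by simp
    then have "d ` B = B" using inv(3) by simp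
    then have memD: "d x \<in> D \<longleftrightarrow> x \<in> D" "d x \<in> B \<longleftrightarrow> x \<in> B" for x
      using inj_image_mem_iff[OF bij_is_inj[OF d'(1)]] inv(2) by metis+
    define s where "s = (\<lambda>(x, b). (if b then c x else d x, b))"
    have s: "s (x, True) = (c x, True)" "s (x, False) = (d x, False)" for x
      by (simp_all add: s_def)
    have sW: "s a \<in> W" if "a \<in> W" for a
    proof -
      obtain x b where "a = (x, b)" by (cases a)
      then show ?thesis using that memC memD c'(5) d'(5) by (cases b) (auto simp: s W_iff)
    qed
    have s_inj: "inj_on s W"
      using c'(4) d'(4) by (auto simp: inj_on_def s_def split: if_splits)
    have cE: "(c x, c y) \<in> E \<longleftrightarrow> (x, y) \<in> E" for x y by (rule c'(3))
    have dE: "(d x, d y) \<in> E \<longleftrightarrow> (x, y) \<in> E" for x y by (rule d'(3))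
    have sF: "(s a, s b) \<in> F \<longleftrightarrow> (a, b) \<in> F" if "a \<in> W" "b \<in> W" for a b
    proof -
      obtain x k y l where ab: "a = (x, k)" "b = (y, l)" by (cases a, cases b)
      \<comment> \<open>Vertices with different tags are adjacent only if one of them lies in
        \<open>B\<close>. The one tagged \<open>True\<close> does not, and on \<open>B\<close> the
        maps \<open>c\<close> and \<open>d\<close> coincide.\<close>
      have mixed: "((s (x, True), s (y, False)) \<in> F) = (((x, True), (y, False)) \<in> F)"
        if "(x, True) \<in> W" "(y, False) \<in> W" for x y
      proof -
        have "x \<notin> B" using that by (simp add: W_iff)
        then show ?thesis
          using sW[OF that(1)] sW[OF that(2)] that memC memD cd cE[of x y]
          by (auto simp: s F_iff)
      qed
      have F_commute: "(u, w) \<in> F \<longleftrightarrow> (w, u) \<in> F" for u w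
        using \<open>graph W F\<close> by (auto simp: graph_def dest: symD)
      show ?thesis
      proof (cases "k = l")
        case True
        then show ?thesis using sW[OF that(1)] sW[OF that(2)] that cE dE unfolding ab
          by (cases l) (auto simp: s F_iff)
      next
        case False
        then show ?thesis using mixed[of x y] mixed[of y x] F_commute that unfolding ab
          by (cases l) auto
      qed
    qed
    obtain f where f: "f \<in> T" "\<And>a. a \<in> W \<Longrightarrow> f (j a) = j (s a)"
      by (rule extend_on_embedded[OF W j(1-3) s_inj _ sF]) (use sW in auto)
    note f' = total_autsD[OF f(1)]
    have fD: "f x = d x" if x: "x \<in> D" for x
    proof (cases "x \<in> V")
      case True
      then have "x \<in> D \<inter> V" "d x \<in> D \<inter> V" using x memD d'(5) by auto
      then show ?thesis using f(2)[of "(x, False)"] j(4) by (simp add: W_iff s)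
    qed (use f'(2) d'(2) in simp)
    have "f (e x) = e (c x)" if x: "x \<in> C" for x
    proof (cases "x \<in> V \<and> x \<notin> B")
      case True
      then have "x \<in> C \<inter> V" "c x \<in> C \<inter> V" "c x \<notin> B" using x memC c'(5) by auto
      then show ?thesis using e(2) f(2)[of "(x, True)"] True x by (simp add: n_def s W_iff)
    next
      case False
      show ?thesis
      proof (cases "x \<in> B")
        case True
        then show ?thesis using eB[of x] eB[of "c x"] memC(2)[of x] fD[of x] cd B(2) by auto
      next
        case False
        then have "x \<notin> V" using \<open>\<not> (x \<in> V \<and> x \<notin> B)\<close> by simp
        then show ?thesis using e'(2) c'(2) f'(2) by simp
      qed
    qed
    then show ?thesis using f(1) fD by blast
  qed
  note key = this
  show ?thesis
  proof (rule bexI[OF _ e(1)], intro conjI ballI impI)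
    fix c d
    assume "c \<in> T" "d \<in> T" and "c ` C = C \<and> d ` D = D \<and> c ` B = B \<and> (\<forall>x\<in>B. c x = d x)"
    then show "\<exists>f\<in>T. (\<forall>x\<in>D. f x = d x) \<and> (\<forall>x\<in>C. f (e x) = e (c x))"
      by (elim conjE) (rule key)
  qed (rule eB)
qed

lemma T_closed:
  assumes "bij f" and "\<And>S. finite S \<Longrightarrow> \<exists>g\<in>T. \<forall>x\<in>S. g x = f x"
  shows "f \<in> T"
proof -
  have "f x = x" if "x \<notin> V" for x
  proof -
    obtain g where "g \<in> T" "g x = f x" using assms(2)[of "{x}"] by auto
    then show ?thesis using total_autsD(2) that by metis
  qed
  moreover have "(f x, f y) \<in> E \<longleftrightarrow> (x, y) \<in> E" for x y
  proof -
    obtain g where "g \<in> T" "g x = f x" "g y = f y" using assms(2)[of "{x, y}"] by auto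
    then show ?thesis using total_autsD(3) by metis
  qed
  ultimately show ?thesis using assms(1) by (simp add: total_auts_def)
qed

lemma T_group: "id \<in> T" "f \<in> T \<Longrightarrow> g \<in> T \<Longrightarrow> f \<circ> g \<in> T" "f \<in> T \<Longrightarrow> pinv f \<in> T"
proof -
  show "id \<in> T" by (simp add: total_auts_def)
  show "f \<circ> g \<in> T" if "f \<in> T" "g \<in> T"
    using that by (auto simp: total_auts_def bij_comp)
  show "pinv f \<in> T" if f: "f \<in> T"
  proof -
    note f' = total_autsD[OF f]
    have "pinv f x = x" if "x \<notin> V" for x using f'(7)[of x] f'(2)[OF that] by simp
    moreover have "(pinv f x, pinv f y) \<in> E \<longleftrightarrow> (x, y) \<in> E" for x y
      using f'(3)[of "pinv f x" "pinv f y"] by (simp add: f'(6))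
    ultimately show ?thesis using f'(1) by (simp add: total_auts_def bij_imp_bij_inv)
  qed
qed

sublocale eppa_perm_group T "from_nat_into V"
proof
  show "g x = x" if "g \<in> T" "x \<notin> range (from_nat_into V)" for g x
  proof -
    \<comment> \<open>Only an inclusion holds in general: for empty \<open>V\<close>, as with
      \<open>m = 1\<close>, the enumeration still takes an arbitrary value.\<close>
    have "x \<notin> V" using that(2) subset_range_from_nat_into[OF countable_V] by blast
    then show ?thesis using total_autsD(2)[OF that(1)] by simp
  qed
qed (fact T_group T_closed eppa amalgamation | erule total_autsD(1))+

lemma small_index: "small_index_property V E"
  unfolding small_index_property_def
proof (intro allI impI, elim conjE)
  fix H
  let ?G = "graph_aut V E"
  assume H: "subgroup H ?G" and small: "rcosets\<^bsub>?G\<^esub> H \<prec> (UNIV :: nat set set)"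
  interpret group ?G by (rule group_graph_aut)
  define H' where "H' = {f \<in> T. restrict f V \<in> H}"
  have res_inv: "inv\<^bsub>?G\<^esub> (restrict f V) = restrict (pinv f) V" if f: "f \<in> T" for f
  proof (rule inv_equality)
    have "restrict id V \<in> carrier ?G" using T_group(1) by (rule restrict_total_aut)
    have "pinv f \<circ> f = id" using total_autsD(7)[OF f] by (simp add: fun_eq_iff)
    then have "restrict (pinv f) V \<otimes>\<^bsub>?G\<^esub> restrict f V = restrict id V"
      using mult_restrict[OF T_group(3)[OF f] f] by simp
    also have "restrict id V = \<one>\<^bsub>?G\<^esub>"
      by (simp add: graph_aut_def BijGroup_def restrict_def fun_eq_iff)
    finally show "restrict (pinv f) V \<otimes>\<^bsub>?G\<^esub> restrict f V = \<one>\<^bsub>?G\<^esub>" .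
  qed (use f T_group(3) restrict_total_aut in auto)
  interpret small_index_subgroup T "from_nat_into V" H'
  proof
    show "h \<in> T" if "h \<in> H'" for h using that by (simp add: H'_def)
    show "g \<circ> h \<in> H'" if "g \<in> H'" "h \<in> H'" for g h
    proof -
      have "g \<in> T" "h \<in> T" "restrict g V \<in> H" "restrict h V \<in> H" using that by (auto simp: H'_def)
      moreover from this have "restrict (g \<circ> h) V \<in> H"
        using subgroup.m_closed[OF H, of "restrict g V" "restrict h V"] mult_restrict by metis
      ultimately show ?thesis using T_group(2) by (simp add: H'_def)
    qed
    show "pinv h \<in> H'" if "h \<in> H'" for h
      using that res_inv[of h] subgroup.m_inv_closed[OF H, of "restrict h V"] T_group(3)
      by (auto simp: H'_def)
    show "\<exists>a b. a \<noteq> b \<and> x a \<circ> pinv (x b) \<in> H'" if x: "\<And>a. x a \<in> T" for x :: "nat set \<Rightarrow> _"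
    proof (rule ccontr)
      assume no: "\<nexists>a b. a \<noteq> b \<and> x a \<circ> pinv (x b) \<in> H'"
      \<comment> \<open>Without a quotient in \<open>H'\<close> these right cosets are pairwise
        distinct, one for each set of natural numbers, against \<open>small\<close>.\<close>
      let ?c = "\<lambda>a. H #>\<^bsub>?G\<^esub> restrict (x a) V"
      have car: "restrict (x a) V \<in> carrier ?G" for a using x by (rule restrict_total_aut)
      have "inj ?c"
      proof (rule injI)
        fix a b assume "?c a = ?c b"
        then have "restrict (x a) V \<in> H #>\<^bsub>?G\<^esub> restrict (x b) V"
          using rcos_self[OF car H] by metis
        then obtain h where h: "h \<in> H" "restrict (x a) V = h \<otimes>\<^bsub>?G\<^esub> restrict (x b) V"
          by (auto simp: r_coset_def)
        have "h \<in> carrier ?G" using h(1) subgroup.mem_carrier[OF H] by blast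
        then have "restrict (x a) V \<otimes>\<^bsub>?G\<^esub> inv\<^bsub>?G\<^esub> (restrict (x b) V) = h"
          using h(2) car by (simp add: m_assoc)
        then have "restrict (x a \<circ> pinv (x b)) V = h"
          using res_inv[OF x[of b]] mult_restrict[OF x[of a] T_group(3)[OF x[of b]]] by simp
        then have "x a \<circ> pinv (x b) \<in> H'" using h(1) x T_group by (simp add: H'_def)
        then show "a = b" using no by blast
      qed
      moreover have "range ?c \<subseteq> rcosets\<^bsub>?G\<^esub> H" using car by (auto simp: RCOSETS_def)
      ultimately have "(UNIV :: nat set set) \<lesssim> rcosets\<^bsub>?G\<^esub> H" unfolding lepoll_def by blast
      then show False using small lepoll_antisym unfolding lesspoll_def by blast
    qed
  qed
  obtain A where A: "finite A" "stab A \<subseteq> H'" using stab_subset_H by blast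
  \<comment> \<open>Automorphisms extended to the whole type are the identity outside
    \<open>V\<close>, so the points of \<open>A\<close> outside \<open>V\<close> impose
    nothing.\<close>
  have "pointwise_stabilizer V E (A \<inter> V) \<subseteq> H"
  proof
    fix g assume "g \<in> pointwise_stabilizer V E (A \<inter> V)"
    then have g: "g \<in> carrier ?G" "\<And>x. x \<in> A \<inter> V \<Longrightarrow> g x = x" by (auto simp: pointwise_stabilizer_def)
    let ?f = "\<lambda>x. if x \<in> V then g x else x"
    have "?f \<in> stab A" using extend_graph_aut[OF g(1) E_subset] g(2) by (auto simp: stab_def)
    then have "restrict ?f V \<in> H" using A(2) by (auto simp: H'_def)
    moreover have "restrict ?f V = g"
      using g(1) by (auto simp: carrier_graph_aut Bij_def extensional_def fun_eq_iff)
    ultimately show "g \<in> H" by simp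
  qed
  then show "\<exists>A. finite A \<and> A \<subseteq> V \<and> pointwise_stabilizer V E A \<subseteq> H"
    using A(1) by (intro exI[of _ "A \<inter> V"]) auto
qed

end

theorem theorem3:
  fixes m :: nat and V :: "'a set" and E :: "'a rel"
  assumes "m \<ge> 1"
    and "generic_complete_free_graph m V E"
  shows "small_index_property V E"
  using assms by (intro generic_graph.small_index generic_graph.intro)

end
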